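(* Let $V$ be a finite-dimensional $\mathbb{K}$-vector space, $\mathbb{K}\in\{\mathbb{R},\mathbb{C}\}$, with $\dim V\ge2$, and let $\nu\in\mathbb{K}\cup\{\infty\}$. Let $\mathcal U_\nu=\{U\in\mathcal T_3V\mid \xi_\nu U=U\}$ be the symmetry class defined by the right ideal $\xi_\nu\cdot\mathbb{K}[\mathcal S_3]$. Then: (a) the tensors $y_t^{*}(U\otimes w)$, with $U\in\mathcal U_\nu$ and $w\in\mathcal T_1V$, linearly span the vector space of algebraic curvature tensors in $\mathcal T_4V$ if and only if $\nu\neq\frac12$; (b') the tensors $y_{t'}^{*}(U\otimes S)$, with $U\in\mathcal U_\nu$ and $S\in\mathcal T_2V$ symmetric, linearly span the vector space of algebraic covariant derivative curvature tensors in $\mathcal T_5V$ if and only if $\nu\neq\frac12$; (c') the tensors $y_{t'}^{*}(U\otimes A)$, with $U\in\mathcal U_\nu$ and $A\in\mathcal T_2V$ skew-symmetric, linearly span the vector space of algebraic covariant derivative curvature tensors in $\mathcal T_5V$ if and only if $\nu\neq\frac12$.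
   Context: $\mathcal T_rV$ is the $\mathbb{K}$-vector space of covariant tensors of order $r$ (i.e. $r$-linear forms) on $V$. An algebraic curvature tensor is $R\in\mathcal T_4V$ with $R_{ijkl}=-R_{jikl}=R_{klij}$ and $R_{ijkl}+R_{iklj}+R_{iljk}=0$. An algebraic covariant derivative curvature tensor is $R'\in\mathcal T_5V$ with $R'_{ijklm}=-R'_{jiklm}=R'_{klijm}$, $R'_{ijklm}+R'_{ikljm}+R'_{iljkm}=0$ and $R'_{ijklm}+R'_{ijlmk}+R'_{ijmkl}=0$. An element $a=\sum_{p\in\mathcal S_r}a(p)\,p\in\mathbb{K}[\mathcal S_r]$ acts on $T\in\mathcal T_rV$ by $(aT)(v_1,\dots,v_r)=\sum_{p}a(p)\,T(v_{p(1)},\dots,v_{p(r)})$. Products of permutations are $(p\circ q)(i)=p(q(i))$, and $a^{*}=\sum_p a(p)\,p^{-1}$. The permutation $p$ of $\{1,2,3\}$ is written $[p(1),p(2),p(3)]$. For a Young tableau $t$, $y_t=\sum_{p\in\mathcal H_t}\sum_{q\in\mathcal V_t}\mathrm{sign}(q)\,p\circ q$, where $\mathcal H_t$, $\mathcal V_t$ are the groups of permutations preserving each row, respectively each column, of $t$. Here $t$ is the tableau with rows $(1,3)$ and $(2,4)$, and $t'$ is the tableau with rows $(1,3,5)$ and $(2,4)$. The elements $\xi_\nu\in\mathbb{K}[\mathcal S_3]$ are the idempotents $$\xi_\infty=\tfrac13\{[1,2,3]-[2,1,3]-[2,3,1]+[3,2,1]\},$$ and, for $\nu\in\mathbb{K}$,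 $$\xi_\nu=\tfrac13\{[1,2,3]+\nu[1,3,2]+(1-\nu)[2,1,3]-\nu[2,3,1]+(-1+\nu)[3,1,2]-[3,2,1]\}.$$ They generate exactly the minimal right ideals of $\mathbb{K}[\mathcal S_3]$ contained in the two-sided ideal $\mathfrak a_{(2\,1)}$ belonging to the partition $(2\,1)$ of $3$. *)

theory Defs
  imports Complex_Main "HOL-Combinatorics.Permutations" "HOL-Library.Function_Algebras"
begin

section \<open>Scalars\<close>

class real_or_complex = field_char_0 +
  assumes iso_real_or_complex:
    "(\<exists>f::'a \<Rightarrow> real. bij f \<and> (\<forall>x y. f (x + y) = f x + f y) \<and> (\<forall>x y. f (x * y) = f x * f y)) \<or>
     (\<exists>f::'a \<Rightarrow> complex. bij f \<and> (\<forall>x y. f (x + y) = f x + f y) \<and> (\<forall>x y. f (x * y) = f x * f y))"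

instance real :: real_or_complex
proof
  show "(\<exists>f::real \<Rightarrow> real. bij f \<and> (\<forall>x y. f (x + y) = f x + f y) \<and> (\<forall>x y. f (x * y) = f x * f y)) \<or>
     (\<exists>f::real \<Rightarrow> complex. bij f \<and> (\<forall>x y. f (x + y) = f x + f y) \<and> (\<forall>x y. f (x * y) = f x * f y))"
    by (intro disjI1 exI[of _ id]) simp
qed

instance complex :: real_or_complex
proof
  show "(\<exists>f::complex \<Rightarrow> real. bij f \<and> (\<forall>x y. f (x + y) = f x + f y) \<and> (\<forall>x y. f (x * y) = f x * f y)) \<or>
     (\<exists>f::complex \<Rightarrow> complex. bij f \<and> (\<forall>x y. f (x + y) = f x + f y) \<and> (\<forall>x y. f (x * y) = f x * f y))"
    by (intro disjI2 exI[of _ id]) simp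
qed

section \<open>Covariant tensors\<close>

text \<open>
  An \<open>r\<close>-tuple \<open>(v\<^sub>1, \<dots>, v\<^sub>r)\<close> of vectors is given by the values at \<open>1, \<dots>, r\<close> of a function
  \<open>v :: nat \<Rightarrow> 'v\<close>. A tensor of order \<open>r\<close> must not depend on the remaining values of \<open>v\<close>, so that
  equality of tensors is equality of \<open>r\<close>-linear forms.
\<close>

type_synonym ('k, 'v) tensor = "(nat \<Rightarrow> 'v) \<Rightarrow> 'k"

definition tensors :: "('k::field \<Rightarrow> 'v::ab_group_add \<Rightarrow> 'v) \<Rightarrow> nat \<Rightarrow> ('k, 'v) tensor set" where
  "tensors scale r = {T.
     (\<forall>v w. (\<forall>i\<in>{1..r}. v i = w i) \<longrightarrow> T v = T w) \<and>
     (\<forall>v. \<forall>i\<in>{1..r}. Vector_Spaces.linear scale (*) (\<lambda>x. T (v(i := x))))}"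

definition args :: "'v::zero list \<Rightarrow> nat \<Rightarrow> 'v" where
  "args xs = (\<lambda>i. if 1 \<le> i \<and> i \<le> length xs then xs ! (i - 1) else 0)"

definition tensor_prod ::
    "nat \<Rightarrow> ('k::times, 'v) tensor \<Rightarrow> ('k, 'v) tensor \<Rightarrow> ('k, 'v) tensor" where
  \<comment> \<open>the first factor has order \<open>r\<close>\<close>
  "tensor_prod r T S = (\<lambda>v. T v * S (\<lambda>i. v (r + i)))"

definition tensor_span :: "('k::field, 'v) tensor set \<Rightarrow> ('k, 'v) tensor set" where
  "tensor_span = module.span (\<lambda>c T v. c * T v)"

definition symmetric_tensors2 ::
    "('k::field \<Rightarrow> 'v::ab_group_add \<Rightarrow> 'v) \<Rightarrow> ('k, 'v) tensor set" where
  "symmetric_tensors2 scale =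
     {S \<in> tensors scale 2. \<forall>x y. S (args [x, y]) = S (args [y, x])}"

definition skew_tensors2 ::
    "('k::field \<Rightarrow> 'v::ab_group_add \<Rightarrow> 'v) \<Rightarrow> ('k, 'v) tensor set" where
  "skew_tensors2 scale =
     {A \<in> tensors scale 2. \<forall>x y. A (args [x, y]) = - A (args [y, x])}"

definition curvature_tensors ::
    "('k::field \<Rightarrow> 'v::ab_group_add \<Rightarrow> 'v) \<Rightarrow> ('k, 'v) tensor set" where
  "curvature_tensors scale = {R \<in> tensors scale 4. \<forall>i j k l.
     R (args [i, j, k, l]) = - R (args [j, i, k, l]) \<and>
     R (args [i, j, k, l]) = R (args [k, l, i, j]) \<and>
     R (args [i, j, k, l]) + R (args [i, k, l, j]) + R (args [i, l, j, k]) = 0}"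

definition derivative_curvature_tensors ::
    "('k::field \<Rightarrow> 'v::ab_group_add \<Rightarrow> 'v) \<Rightarrow> ('k, 'v) tensor set" where
  "derivative_curvature_tensors scale = {R \<in> tensors scale 5. \<forall>i j k l m.
     R (args [i, j, k, l, m]) = - R (args [j, i, k, l, m]) \<and>
     R (args [i, j, k, l, m]) = R (args [k, l, i, j, m]) \<and>
     R (args [i, j, k, l, m]) + R (args [i, k, l, j, m]) + R (args [i, l, j, k, m]) = 0 \<and>
     R (args [i, j, k, l, m]) + R (args [i, j, l, m, k]) + R (args [i, j, m, k, l]) = 0}"

section \<open>Group ring elements of symmetric groups\<close>

text \<open>
  An element of the group ring of \<open>\<S>\<^sub>r\<close> is given by its coefficients at the permutations of
  \<open>{1..r}\<close>, which are functions \<open>nat \<Rightarrow> nat\<close> fixing everything else. The order \<open>r\<close> is supplied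
  when the element acts.
\<close>

type_synonym 'k group_ring = "(nat \<Rightarrow> nat) \<Rightarrow> 'k"

definition act :: "nat \<Rightarrow> 'k::field group_ring \<Rightarrow> ('k, 'v) tensor \<Rightarrow> ('k, 'v) tensor" where
  "act r a T = (\<lambda>v. \<Sum>p | p permutes {1..r}. a p * T (v \<circ> p))"

definition star :: "'k group_ring \<Rightarrow> 'k group_ring" where
  "star a = (\<lambda>p. a (inv p))"

definition perm :: "nat list \<Rightarrow> nat \<Rightarrow> nat" where
  "perm xs = (\<lambda>i. if 1 \<le> i \<and> i \<le> length xs then xs ! (i - 1) else i)"

definition single :: "(nat \<Rightarrow> nat) \<Rightarrow> 'k::field group_ring" where
  "single q = (\<lambda>p. if p = q then 1 else 0)"

text \<open>A tableau is the list of its rows.\<close>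

type_synonym tableau = "nat list list"

definition column :: "tableau \<Rightarrow> nat \<Rightarrow> nat set" where
  "column t j = {row ! j | row. row \<in> set t \<and> j < length row}"

definition row_group :: "tableau \<Rightarrow> (nat \<Rightarrow> nat) set" where
  "row_group t = {p. p permutes set (concat t) \<and> (\<forall>row\<in>set t. p ` set row = set row)}"

definition column_group :: "tableau \<Rightarrow> (nat \<Rightarrow> nat) set" where
  "column_group t = {q. q permutes set (concat t) \<and> (\<forall>j. q ` column t j = column t j)}"

definition young_symmetrizer :: "tableau \<Rightarrow> 'k::field group_ring" where
  "young_symmetrizer t =
     (\<lambda>s. \<Sum>p\<in>row_group t. \<Sum>q\<in>column_group t. of_int (sign q) * single (p \<circ> q) s)"

text \<open>The parameter \<open>\<infinity>\<close> is represented by \<^term>\<open>None\<close>.\<close>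

fun xi :: "'k::field option \<Rightarrow> 'k group_ring" where
  "xi None = (\<lambda>p. 1/3 *
     (single (perm [1,2,3]) p - single (perm [2,1,3]) p
      - single (perm [2,3,1]) p + single (perm [3,2,1]) p))"
| "xi (Some \<nu>) = (\<lambda>p. 1/3 *
     (single (perm [1,2,3]) p + \<nu> * single (perm [1,3,2]) p
      + (1 - \<nu>) * single (perm [2,1,3]) p - \<nu> * single (perm [2,3,1]) p
      + (-1 + \<nu>) * single (perm [3,1,2]) p - single (perm [3,2,1]) p))"

definition sym_class ::
    "('k::field \<Rightarrow> 'v::ab_group_add \<Rightarrow> 'v) \<Rightarrow> 'k option \<Rightarrow> ('k, 'v) tensor set" where
  "sym_class scale \<nu> = {U \<in> tensors scale 3. act 3 (xi \<nu>) U = U}"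

end

theory Submission
  imports Defs
begin

text \<open>
  The operator \<open>y\<^sub>t\<^sup>*\<close> first symmetrises over the rows of \<open>t\<close> and then alternates over its columns, and
  it multiplies curvature tensors by \<open>12\<close> (respectively \<open>24\<close> for \<open>t'\<close>). Row symmetrisation kills
  every tensor that is skew in the slots 1 and 3. The tensors in \<open>\<U>\<^sub>\<nu>\<close> with \<open>\<nu> = 1/2\<close> are skew in these
  slots, so only \<open>0\<close> is generated in this case. For any other \<open>\<nu>\<close> take a curvature tensor \<open>R\<close>, exchange
  its slots 2 and 3 and apply \<open>\<xi>\<^sub>\<nu>\<close> to the first three slots. As \<open>R\<close> is skew in the slots 1 and 2, the
  result agrees with a nonzero multiple of \<open>R\<close> up to a tensor that is skew in the slots 1 and 3, so
  \<open>y\<^sub>t\<^sup>*\<close> maps it to a nonzero multiple of \<open>R\<close>. Expanding the remaining slots in a dual basis writes it as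
  a sum of products \<open>U \<otimes> w\<close>. For \<open>t'\<close> one moreover (skew-)symmetrises \<open>R\<close> in the slots 4 and 5, which
  costs nothing: exchanging the slots 4 and 5 of \<open>R\<close> gives a tensor that is skew in the slots 3 and 5
  of the first row, hence annihilated.
\<close>

section \<open>Explicit form of the Young symmetrizers\<close>

text \<open>Restricting \<open>s\<close> to \<open>A\<close> and to \<open>B\<close>, each extended
  by the identity, inverts \<open>(p, q) \<mapsto> p \<circ> q\<close>: the common stabiliser of two
  disjoint blocks is the direct product of their symmetric groups. Row and column groups are then
  summed block by block.\<close>

lemma sum_permutes_Un:
  assumes "finite A" "finite B" "A \<inter> B = {}"
  shows "(\<Sum>s | s permutes A \<union> B \<and> s ` A = A \<and> s ` B = B. f s) =
         (\<Sum>p | p permutes A. \<Sum>q | q permutes B. f (p \<circ> q))"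
proof -
  define P where "P = {p. p permutes A} \<times> {q. q permutes B}"
  define on where "on C s = (\<lambda>x. if x \<in> C then s x else x)" for C and s :: "'a \<Rightarrow> 'a"
  have permutes_on: "on C s permutes C" if "s permutes A \<union> B" "s ` C = C" for C s
  proof (rule bij_imp_permutes)
    have "bij_betw s C C"
      using that permutes_inj[of s] by (auto simp: bij_betw_def intro: inj_on_subset)
    then show "bij_betw (on C s) C C"
      by (rule bij_betw_cong[THEN iffD1, rotated]) (simp add: on_def)
  qed (simp add: on_def)
  have "(\<Sum>s | s permutes A \<union> B \<and> s ` A = A \<and> s ` B = B. f s) = (\<Sum>(p, q)\<in>P. f (p \<circ> q))"
  proof (rule sum.reindex_bij_witness[where i = "\<lambda>(p, q). p \<circ> q" and j = "\<lambda>s. (on A s, on B s)"])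
    fix s assume s: "s \<in> {s. s permutes A \<union> B \<and> s ` A = A \<and> s ` B = B}"
    have "(on A s \<circ> on B s) x = s x" for x
    proof (cases "x \<in> B")
      case True
      then have "s x \<in> B" using s by blast
      then show ?thesis using True assms by (auto simp: on_def)
    next
      case False
      then show ?thesis using s by (auto simp: on_def permutes_not_in)
    qed
    then have "on A s \<circ> on B s = s" by blast
    then show "(case (on A s, on B s) of (p, q) \<Rightarrow> p \<circ> q) = s" "(case (on A s, on B s) of (p, q) \<Rightarrow> f (p \<circ> q)) = f s"
      by simp_all
    show "(on A s, on B s) \<in> P"
      using s permutes_on by (simp add: P_def)
  next
    fix pq assume "pq \<in> P"
    then obtain p q where pq: "pq = (p, q)" "p permutes A" "q permutes B"
      by (auto simp: P_def)
    have qA: "q x = x" if "x \<in> A" for x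
      using that permutes_not_in[OF pq(3)] assms(3) by blast
    have pB: "p x = x" if "x \<in> B" for x
      using that permutes_not_in[OF pq(2)] assms(3) by blast
    have qB: "q x \<in> B \<longleftrightarrow> x \<in> B" for x
      using pq(3) by (rule permutes_in_image)
    have "on A (p \<circ> q) = p" "on B (p \<circ> q) = q"
      using pq(2,3) qA pB qB by (auto simp: on_def fun_eq_iff permutes_not_in)
    then show "(on A (case pq of (p, q) \<Rightarrow> p \<circ> q), on B (case pq of (p, q) \<Rightarrow> p \<circ> q)) = pq"
      using pq(1) by simp
    have "q ` A = A" "p ` B = B" using qA pB by simp_all
    then have "(p \<circ> q) ` A = A" "(p \<circ> q) ` B = B"
      using permutes_image[OF pq(2)] permutes_image[OF pq(3)] by (simp_all only: image_comp[symmetric])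
    moreover have "p \<circ> q permutes A \<union> B"
      using pq(2,3) by (intro permutes_compose) (auto intro: permutes_subset)
    ultimately show "(case pq of (p, q) \<Rightarrow> p \<circ> q) \<in> {s. s permutes A \<union> B \<and> s ` A = A \<and> s ` B = B}"
      using pq(1) by simp
  qed
  also have "\<dots> = (\<Sum>p | p permutes A. \<Sum>q | q permutes B. f (p \<circ> q))"
    by (simp add: P_def sum.cartesian_product)
  finally show ?thesis .
qed

lemma inv_row_group: "p \<in> row_group t \<Longrightarrow> inv p \<in> row_group t"
  by (auto simp: row_group_def intro: permutes_inv)
     (metis image_inv_f_f permutes_inj image_eqI permutes_inverses(2))+

lemma inv_column_group: "q \<in> column_group t \<Longrightarrow> inv q \<in> column_group t"
  unfolding column_group_def
  by (auto intro: permutes_inv)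
     (metis image_inv_f_f permutes_inj image_eqI permutes_inverses(2))+

lemma sum_single_permutes:
  assumes "s permutes {1..r}"
  shows "(\<Sum>p | p permutes {1..r}. single s p * T (v \<circ> p)) = T (v \<circ> s)"
proof -
  have "(\<Sum>p | p permutes {1..r}. single s p * T (v \<circ> p)) =
      (\<Sum>p | p permutes {1..r}. if p = s then T (v \<circ> p) else 0)"
    by (intro sum.cong) (auto simp: single_def)
  then show ?thesis
    using assms by (simp add: finite_permutations)
qed

text \<open>The involution \<open>star\<close> turns \<open>p \<circ> q\<close> into
  \<open>inv q \<circ> inv p\<close>, and both groups are closed under inversion, which preserves
  signs. So the sum may run over \<open>q \<circ> p\<close>: the inner sum is the row symmetrisation
  of \<open>T\<close>, taken at \<open>v \<circ> q\<close>.\<close>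

lemma act_star_young_symmetrizer:
  fixes T :: "('k::field, 'v) tensor"
  assumes t: "set (concat t) = {1..r}"
  shows "act r (star (young_symmetrizer t)) T v =
    (\<Sum>q\<in>column_group t. of_int (sign q) * (\<Sum>p\<in>row_group t. T (v \<circ> (q \<circ> p))))"
proof -
  have row: "p permutes {1..r}" if "p \<in> row_group t" for p
    using that t by (simp add: row_group_def)
  have col: "q permutes {1..r}" if "q \<in> column_group t" for q
    using that t by (simp add: column_group_def)
  have single_inv: "single (p \<circ> q) (inv s) = (single (inv q \<circ> inv p) s :: 'k)"
    if "p \<in> row_group t" "q \<in> column_group t" "s permutes {1..r}" for p q s
  proof -
    have "inv (p \<circ> q) = inv q \<circ> inv p"
      using row[OF that(1)] col[OF that(2)] by (simp add: o_inv_distrib permutes_bij)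
    moreover have "inv (inv s) = s" "inv (inv (p \<circ> q)) = p \<circ> q"
      using that permutes_compose[OF col[OF that(2)] row[OF that(1)]]
      by (auto intro: permutes_inv_inv)
    ultimately show ?thesis
      by (auto simp: single_def)
  qed
  have "act r (star (young_symmetrizer t)) T v =
      (\<Sum>s | s permutes {1..r}. \<Sum>p\<in>row_group t. \<Sum>q\<in>column_group t.
        of_int (sign q) * (single (inv q \<circ> inv p) s * T (v \<circ> s)))"
    unfolding act_def star_def young_symmetrizer_def
    by (intro sum.cong refl) (simp add: sum_distrib_right single_inv mult.assoc)
  also have "\<dots> = (\<Sum>p\<in>row_group t. \<Sum>q\<in>column_group t. of_int (sign q) *
      (\<Sum>s | s permutes {1..r}. single (inv q \<circ> inv p) s * T (v \<circ> s)))"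
    by (rule trans[OF sum.swap], rule sum.cong[OF refl], rule trans[OF sum.swap])
       (simp add: sum_distrib_left)
  also have "\<dots> = (\<Sum>p\<in>row_group t. \<Sum>q\<in>column_group t. of_int (sign q) * T (v \<circ> (inv q \<circ> inv p)))"
    by (intro sum.cong refl arg_cong2[where f = "(*)"] sum_single_permutes permutes_compose permutes_inv row col)
  also have "\<dots> = (\<Sum>p\<in>row_group t. \<Sum>q\<in>column_group t. of_int (sign q) * T (v \<circ> (q \<circ> p)))"
  proof (rule sum.reindex_bij_witness[where i = inv and j = inv])
    fix p assume "p \<in> row_group t"
    show "(\<Sum>q\<in>column_group t. of_int (sign q) * T (v \<circ> (q \<circ> inv p))) =
          (\<Sum>q\<in>column_group t. of_int (sign q) * T (v \<circ> (inv q \<circ> inv p)))"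
    proof (rule sum.reindex_bij_witness[where i = inv and j = inv])
      fix q assume "q \<in> column_group t"
      then have q: "q permutes {1..r}" by (rule col)
      then have "permutation q" by (auto simp: permutation_permutes)
      with q show "of_int (sign (inv q)) * T (v \<circ> (inv (inv q) \<circ> inv p)) = of_int (sign q) * T (v \<circ> (q \<circ> inv p))"
        by (simp add: sign_inverse permutes_inv_inv)
    qed (auto simp: permutes_inv_inv[OF col] inv_column_group)
  qed (auto simp: permutes_inv_inv[OF row] inv_row_group)
  also have "\<dots> = (\<Sum>q\<in>column_group t. of_int (sign q) * (\<Sum>p\<in>row_group t. T (v \<circ> (q \<circ> p))))"
    by (subst sum.swap) (simp add: sum_distrib_left)
  finally show ?thesis .
qed

section \<open>Row and column groups of the two tableaux\<close>

lemma sum_permutes_pair: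
  assumes "a \<noteq> b"
  shows "(\<Sum>p | p permutes {a, b}. f p) = f id + f (transpose a b)"
  using assms by (simp add: sum_over_permutations_insert)

lemma sum_permutes_135:
  "(\<Sum>p | p permutes {1, 3, 5::nat}. f p) =
    f id + f (transpose 3 5) + (f (transpose 1 3) + f (transpose 1 3 \<circ> transpose 3 5))
    + (f (transpose 1 5) + f (transpose 1 5 \<circ> transpose 3 5))"
  by (simp add: sum_over_permutations_insert add.assoc)

text \<open>Serves the one-element column {5} of the larger tableau: it forces 5 to be fixed, so
  both tableaux have the same column group.\<close>

lemma permutes_insert_fixed:
  assumes "a \<notin> A"
  shows "q permutes insert a A \<and> q ` {a} = {a} \<longleftrightarrow> q permutes A"
  using assms unfolding permutes_def by auto

lemma column_Cons: "column (row # t) j = (if j < length row then insert (row ! j) (column t j) else column t j)"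
  by (auto simp: column_def)

lemma column_Nil: "column [] j = {}"
  by (simp add: column_def)

text \<open>In \<open>column_group\<close> the column index ranges over all naturals. A tableau with
  at most three columns has a constant (empty) column from some index on, so the quantifier
  collapses to finitely many conditions.\<close>

lemma all_nat_cases_0_1_2:
  "(\<forall>j::nat. P (if j = 0 then A else if j = 1 then B else if j = 2 then C else D)) \<longleftrightarrow> P A \<and> P B \<and> P C \<and> P D"
proof
  assume *: "\<forall>j::nat. P (if j = 0 then A else if j = 1 then B else if j = 2 then C else D)"
  show "P A \<and> P B \<and> P C \<and> P D"
    using *[rule_format, of 0] *[rule_format, of 1] *[rule_format, of 2] *[rule_format, of 3] by simp
qed simp

lemma column_group_2_2: "column_group [[1,3],[2,4]] =
   {q. q permutes {1,2} \<union> {3,4} \<and> q ` {1,2} = {1,2} \<and> q ` {3,4} = {3,4}}"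
proof -
  have "set (concat [[1,3],[2,4]]) = {1,2} \<union> {3,4::nat}" by auto
  \<comment> \<open>The case \<open>j = 2\<close> is listed separately to match the pattern of
    \<open>all_nat_cases_0_1_2\<close>.\<close>
  moreover have "column [[1,3],[2,4]] =
      (\<lambda>j. if j = 0 then {1,2} else if j = 1 then {3,4} else if j = 2 then {} else {})"
    by (auto simp: fun_eq_iff column_Cons column_Nil nth_Cons')
  ultimately show ?thesis
    using all_nat_cases_0_1_2[where P = "\<lambda>C. q ` C = C" for q :: "nat \<Rightarrow> nat"]
    unfolding column_group_def by simp
qed

lemma row_group_2_2: "row_group [[1,3],[2,4]] =
   {q. q permutes {1,3} \<union> {2,4} \<and> q ` {1,3} = {1,3} \<and> q ` {2,4} = {2,4}}"
proof -
  have "{1,3,2,4} = {1,3} \<union> {2,4::nat}" by auto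
  then show ?thesis
    by (auto simp: row_group_def)
qed

lemma row_group_3_2: "row_group [[1,3,5],[2,4]] =
   {q. q permutes {1,3,5} \<union> {2,4} \<and> q ` {1,3,5} = {1,3,5} \<and> q ` {2,4} = {2,4}}"
proof -
  have "{1,3,5,2,4} = {1,3,5} \<union> {2,4::nat}" by auto
  then show ?thesis
    by (auto simp: row_group_def)
qed

lemma column_group_3_2: "column_group [[1,3,5],[2,4]] =
   {q. q permutes {1,2} \<union> {3,4} \<and> q ` {1,2} = {1,2} \<and> q ` {3,4} = {3,4}}"
proof -
  have "set (concat [[1,3,5],[2,4]]) = insert 5 ({1,2} \<union> {3,4::nat})" by auto
  moreover have "column [[1,3,5],[2,4]] =
      (\<lambda>j. if j = 0 then {1,2} else if j = 1 then {3,4} else if j = 2 then {5} else {})"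
    by (auto simp: fun_eq_iff column_Cons column_Nil nth_Cons')
  ultimately have "column_group [[1,3,5],[2,4]] = {q. q permutes insert 5 ({1,2} \<union> {3,4}) \<and>
      q ` {1,2} = {1,2} \<and> q ` {3,4} = {3,4} \<and> q ` {5} = {5}}"
    using all_nat_cases_0_1_2[where P = "\<lambda>C. q ` C = C" for q :: "nat \<Rightarrow> nat"]
    unfolding column_group_def by simp
  then show ?thesis
    using permutes_insert_fixed[of 5 "{1,2} \<union> {3,4::nat}"] by auto
qed

lemma sum_column_group:
  assumes "t \<in> {[[1,3],[2,4]], [[1,3,5],[2,4]]}"
  shows "(\<Sum>q\<in>column_group t. f q) =
    f id + f (transpose 3 4) + f (transpose 1 2) + f (transpose 1 2 \<circ> transpose 3 4)"
proof -
  have "(\<Sum>q\<in>column_group t. f q) = (\<Sum>p | p permutes {1,2}. \<Sum>q | q permutes {3,4}. f (p \<circ> q))"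
    using assms column_group_2_2 column_group_3_2 sum_permutes_Un[of "{1,2}" "{3,4}" f] by auto
  then show ?thesis
    by (simp add: sum_permutes_pair add.assoc)
qed

lemma sum_row_group_2_2:
  "(\<Sum>p\<in>row_group [[1,3],[2,4]]. f p) =
    f id + f (transpose 2 4) + f (transpose 1 3) + f (transpose 1 3 \<circ> transpose 2 4)"
proof -
  have "(\<Sum>p\<in>row_group [[1,3],[2,4]]. f p) = (\<Sum>p | p permutes {1,3}. \<Sum>q | q permutes {2,4}. f (p \<circ> q))"
    unfolding row_group_2_2 by (rule sum_permutes_Un) auto
  then show ?thesis
    by (simp add: sum_permutes_pair add.assoc)
qed

lemma sum_row_group_3_2:
  "(\<Sum>p\<in>row_group [[1,3,5],[2,4]]. f p) =
    (\<Sum>p | p permutes {1,3,5}. f p + f (p \<circ> transpose 2 4))"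
proof -
  have "(\<Sum>p\<in>row_group [[1,3,5],[2,4]]. f p) = (\<Sum>p | p permutes {1,3,5}. \<Sum>q | q permutes {2,4}. f (p \<circ> q))"
    unfolding row_group_3_2 by (rule sum_permutes_Un) auto
  then show ?thesis
    by (simp add: sum_permutes_pair)
qed

text \<open>
  With the values of a tensor as a curried function \<open>F\<close>, the row sums distribute the arguments before
  \<open>d, e\<close> over the first row of the tableau (the odd slots) and \<open>d, e\<close> over the second one. Since
  \<^term>\<open>star\<close> reverses products, the rows are symmetrised first and the columns
  alternated afterwards.
\<close>

definition row_sum4 :: "('v \<Rightarrow> 'v \<Rightarrow> 'v \<Rightarrow> 'v \<Rightarrow> 'k) \<Rightarrow> 'v \<Rightarrow> 'v \<Rightarrow> 'v \<Rightarrow> 'v \<Rightarrow> 'k::ab_group_add" where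
  "row_sum4 F a b d e = F a d b e + F b d a e + F a e b d + F b e a d"

definition young4 :: "('v \<Rightarrow> 'v \<Rightarrow> 'v \<Rightarrow> 'v \<Rightarrow> 'k) \<Rightarrow> 'v \<Rightarrow> 'v \<Rightarrow> 'v \<Rightarrow> 'v \<Rightarrow> 'k::ab_group_add" where
  "young4 F i j k l =
     row_sum4 F i k j l - row_sum4 F j k i l - row_sum4 F i l j k + row_sum4 F j l i k"

definition row_sum5 ::
    "('v \<Rightarrow> 'v \<Rightarrow> 'v \<Rightarrow> 'v \<Rightarrow> 'v \<Rightarrow> 'k) \<Rightarrow> 'v \<Rightarrow> 'v \<Rightarrow> 'v \<Rightarrow> 'v \<Rightarrow> 'v \<Rightarrow> 'k::ab_group_add" where
  "row_sum5 F a b c d e =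
     F a d b e c + F a d c e b + F b d a e c + F b d c e a + F c d a e b + F c d b e a +
     F a e b d c + F a e c d b + F b e a d c + F b e c d a + F c e a d b + F c e b d a"

definition young5 ::
    "('v \<Rightarrow> 'v \<Rightarrow> 'v \<Rightarrow> 'v \<Rightarrow> 'v \<Rightarrow> 'k) \<Rightarrow> 'v \<Rightarrow> 'v \<Rightarrow> 'v \<Rightarrow> 'v \<Rightarrow> 'v \<Rightarrow> 'k::ab_group_add" where
  "young5 F i j k l m =
     row_sum5 F i k m j l - row_sum5 F j k m i l - row_sum5 F i l m j k + row_sum5 F j l m i k"

lemma permutation_simps: "permutation (transpose a b)" "permutation id"
  by (simp_all add: permutation_swap_id permutation_id)

lemma act_young_2_2:
  fixes T :: "('k::field, 'v) tensor"
  assumes T: "\<And>v. T v = F (v 1) (v 2) (v 3) (v 4)"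
  shows "act 4 (star (young_symmetrizer [[1,3],[2,4]])) T v = young4 F (v 1) (v 2) (v 3) (v 4)"
proof -
  have "set (concat [[1,3],[2,4]]) = {1..4::nat}" by auto
  from act_star_young_symmetrizer[OF this, of T v] show ?thesis
    by (simp add: sum_column_group[simplified] sum_row_group_2_2[simplified] sign_compose sign_swap_id permutation_simps
          transpose_def T young4_def row_sum4_def algebra_simps)
qed

lemma act_young_3_2:
  fixes T :: "('k::field, 'v) tensor"
  assumes T: "\<And>v. T v = F (v 1) (v 2) (v 3) (v 4) (v 5)"
  shows "act 5 (star (young_symmetrizer [[1,3,5],[2,4]])) T v =
    young5 F (v 1) (v 2) (v 3) (v 4) (v 5)"
proof -
  have "set (concat [[1,3,5],[2,4]]) = {1..5::nat}" by auto
  from act_star_young_symmetrizer[OF this, of T v] show ?thesis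
    by (simp add: sum_column_group[simplified] sum_row_group_3_2[simplified] sum_permutes_135[simplified] sign_compose
          sign_swap_id permutation_simps transpose_def T young5_def row_sum5_def algebra_simps)
qed

section \<open>Action of \<open>xi\<close> on tensors of order three\<close>

lemma perm_permutes:
  assumes "distinct xs" "set xs = {1..length xs}"
  shows "perm xs permutes {1..length xs}"
proof (rule bij_imp_permutes)
  have "bij_betw (\<lambda>i. i - 1) {1..length xs} {..<length xs}"
    by (rule bij_betw_byWitness[where f' = Suc]) auto
  moreover have "bij_betw ((!) xs) {..<length xs} {1..length xs}"
    using assms by (intro bij_betw_nth) auto
  ultimately have "bij_betw ((!) xs \<circ> (\<lambda>i. i - 1)) {1..length xs} {1..length xs}"
    by (rule bij_betw_trans)
  then show "bij_betw (perm xs) {1..length xs} {1..length xs}"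
    by (rule bij_betw_cong[THEN iffD1, rotated]) (simp add: perm_def)
qed (auto simp: perm_def)

fun xi_action :: "'k::field option \<Rightarrow> ('v \<Rightarrow> 'v \<Rightarrow> 'v \<Rightarrow> 'k) \<Rightarrow> 'v \<Rightarrow> 'v \<Rightarrow> 'v \<Rightarrow> 'k" where
  "xi_action None F a b c = 1/3 * (F a b c - F b a c - F b c a + F c b a)"
| "xi_action (Some \<nu>) F a b c = 1/3 * (F a b c + \<nu> * F a c b + (1 - \<nu>) * F b a c - \<nu> * F b c a
     + (-1 + \<nu>) * F c a b - F c b a)"

lemma act_xi:
  fixes T :: "('k::field, 'v) tensor"
  assumes T: "\<And>v. T v = F (v 1) (v 2) (v 3)"
  shows "act 3 (xi \<nu>) T v = xi_action \<nu> F (v 1) (v 2) (v 3)"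
proof -
  have *: "(\<Sum>p | p permutes {1..3}. single (perm xs) p * T (v \<circ> p)) = F (v (xs ! 0)) (v (xs ! 1)) (v (xs ! 2))"
    if "xs \<in> set [[1,2,3], [1,3,2], [2,1,3], [2,3,1], [3,1,2], [3,2,1]]" for xs
  proof -
    have "{1..3} = {1,2,3::nat}" by auto
    then have "length xs = 3" "distinct xs" "set xs = {1..length xs}"
      using that by auto
    moreover from this have "perm xs permutes {1..3}"
      using perm_permutes[of xs] by simp
    ultimately show ?thesis
      using sum_single_permutes[of "perm xs" 3 T v] by (simp add: T perm_def)
  qed
  \<comment> \<open>The factor 1/3 is kept opaque, so that only linearity of the sums over
    permutations remains to be used.\<close>
  define c :: 'k where "c = 1/3"
  define S where "S xs = (\<Sum>p | p permutes {1..3}. single (perm xs) p * T (v \<circ> p))" for xs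
  have S: "S [1,2,3] = F (v 1) (v 2) (v 3)" "S [1,3,2] = F (v 1) (v 3) (v 2)"
    "S [2,1,3] = F (v 2) (v 1) (v 3)" "S [2,3,1] = F (v 2) (v 3) (v 1)"
    "S [3,1,2] = F (v 3) (v 1) (v 2)" "S [3,2,1] = F (v 3) (v 2) (v 1)"
    unfolding S_def by (subst *; simp)+
  show ?thesis
  proof (cases \<nu>)
    case None
    have "act 3 (xi \<nu>) T v = c * (S [1,2,3] - S [2,1,3] - S [2,3,1] + S [3,2,1])"
      unfolding act_def S_def None xi.simps c_def[symmetric]
      by (simp add: sum_distrib_left sum.distrib sum_subtractf algebra_simps)
    then show ?thesis
      by (simp only: None S xi_action.simps c_def)
  next
    case (Some n)
    have "act 3 (xi \<nu>) T v = c * (S [1,2,3] + n * S [1,3,2] + (1 - n) * S [2,1,3] - n * S [2,3,1]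
        + (-1 + n) * S [3,1,2] - S [3,2,1])"
      unfolding act_def S_def Some xi.simps c_def[symmetric]
      by (simp add: sum_distrib_left sum.distrib sum_subtractf algebra_simps)
    then show ?thesis
      by (simp only: Some S xi_action.simps c_def)
  qed
qed

section \<open>Curvature identities\<close>

lemma row_sum4_sym:
  "row_sum4 F b a d e = row_sum4 F a b d e" "row_sum4 F a b e d = row_sum4 F a b d e"
  by (simp_all add: row_sum4_def add_ac)

lemma row_sum5_sym:
  "row_sum5 F b a c d e = row_sum5 F a b c d e" "row_sum5 F a c b d e = row_sum5 F a b c d e"
  "row_sum5 F a b c e d = row_sum5 F a b c d e"
  by (simp_all add: row_sum5_def add_ac)

text \<open>Valid for arbitrary \<open>F\<close>: after expansion into row sums the terms cancel,
  because \<open>row_sum4\<close> is symmetric in the arguments of each row.\<close>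

lemma young4_identities:
  "young4 F i j k l = - young4 F j i k l"
  "young4 F i j k l = young4 F k l i j"
  "young4 F i j k l + young4 F i k l j + young4 F i l j k = 0"
  by (simp_all add: young4_def row_sum4_sym algebra_simps)

text \<open>The same cancellation, now with a row sum symmetric in three arguments. The last
  identity cancels because \<open>m\<close> shares the first row with one of \<open>k\<close>,
  \<open>l\<close>, or both stand in different rows with opposite sign in another cyclic
  term.\<close>

lemma young5_identities:
  "young5 F i j k l m = - young5 F j i k l m"
  "young5 F i j k l m = young5 F k l i j m"
  "young5 F i j k l m + young5 F i k l j m + young5 F i l j k m = 0"
  "young5 F i j k l m + young5 F i j l m k + young5 F i j m k l = 0"
  by (simp_all add: young5_def row_sum5_sym algebra_simps)

text \<open>The slots 1 and 3 form a row of the tableau, so the terms of every row sum cancel in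
  pairs.\<close>

lemma young4_skew13:
  assumes "\<And>a b c d. F a b c d = - F c b a d"
  shows "young4 F i j k l = 0"
proof -
  have "row_sum4 F a b d e = 0" for a b d e
    using assms[of a d b e] assms[of a e b d] by (simp add: row_sum4_def)
  then show ?thesis by (simp add: young4_def)
qed

lemma young5_skew13:
  assumes "\<And>a b c d e. F a b c d e = - F c b a d e"
  shows "young5 F i j k l m = 0"
proof -
  have "row_sum5 F a b c d e = 0" for a b c d e
    using assms[of a d b e c] assms[of a d c e b] assms[of b d c e a]
      assms[of a e b d c] assms[of a e c d b] assms[of b e c d a]
    by (simp add: row_sum5_def)
  then show ?thesis by (simp add: young5_def)
qed

text \<open>Here the skew slots are 3 and 5, which lie in the first row, so the row sums again
  cancel in pairs. This disposes of the term produced by exchanging the slots 4 and 5 of a curvature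
  tensor.\<close>

lemma young5_skew34:
  assumes "\<And>a b c d e. F a b c d e = - F a b e d c"
  shows "young5 F i j k l m = 0"
proof -
  have "row_sum5 F a b c d e = 0" for a b c d e
    using assms[of a d b e c] assms[of b d a e c] assms[of c d a e b]
      assms[of a e b d c] assms[of b e a d c] assms[of c e a d b]
    by (simp add: row_sum5_def)
  then show ?thesis by (simp add: young5_def)
qed

text \<open>Skewness and pair symmetry bring both terms to the leading index \<open>i\<close>: the
  first becomes \<open>- F i l j k\<close>, the second \<open>F i k l j\<close>. The Bianchi
  identity evaluates their difference.\<close>

lemma curvature_exchange:
  fixes F :: "'v \<Rightarrow> 'v \<Rightarrow> 'v \<Rightarrow> 'v \<Rightarrow> 'k::ab_group_add"
  assumes skew: "\<And>i j k l. F i j k l = - F j i k l"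
    and pair: "\<And>i j k l. F i j k l = F k l i j"
    and bianchi: "\<And>i j k l. F i j k l + F i k l j + F i l j k = 0"
  shows "F i l k j - F j l k i = F i j k l"
proof -
  have "F j l k i = - F i k j l"
    using pair[of j l k i] skew[of k i j l] by simp
  moreover have "F i k j l = - F i k l j"
    using pair[of i k j l] skew[of j l i k] pair[of i k l j] by simp
  moreover have "F i l k j = - F i l j k"
    using pair[of i l k j] skew[of k j i l] pair[of i l j k] by simp
  moreover have "F i l j k = - (F i j k l + F i k l j)"
    using bianchi[of i j k l] by (simp only: add_eq_0_iff)
  ultimately show ?thesis by simp
qed

text \<open>By pair symmetry the alternated row sums reduce to eight terms with factor 2. Four of
  them equal \<open>F i j k l\<close> up to the compensating sign and contribute 8; the other four
  combine through \<open>curvature_exchange\<close> and contribute 4.\<close>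

lemma young4_curvature:
  fixes F :: "'v \<Rightarrow> 'v \<Rightarrow> 'v \<Rightarrow> 'v \<Rightarrow> 'k::field"
  assumes skew: "\<And>i j k l. F i j k l = - F j i k l"
    and pair: "\<And>i j k l. F i j k l = F k l i j"
    and bianchi: "\<And>i j k l. F i j k l + F i k l j + F i l j k = 0"
  shows "young4 F i j k l = 12 * F i j k l"
proof -
  have row: "row_sum4 F a b d e = 2 * (F a d b e + F a e b d)" for a b d e
    using pair[of b d a e] pair[of b e a d] by (simp add: row_sum4_def algebra_simps)
  have skew': "F a b d e = - F a b e d" for a b d e
    using pair[of a b d e] skew[of d e a b] pair[of a b e d] by simp
  have exchange: "F a d c b = F a b c d + F b d c a" for a b c d
    using curvature_exchange[where F = F and i = a and l = d and k = c and j = b, OF assms] by (simp add: algebra_simps)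
  show ?thesis
    unfolding young4_def row
    by (simp only: exchange[of i l k j] exchange[of i k l j]
          skew[of j i k l] skew'[of i j l k] skew[of j i l k])
       (simp add: algebra_simps)
qed

lemma young5_curvature:
  fixes F :: "'v \<Rightarrow> 'v \<Rightarrow> 'v \<Rightarrow> 'v \<Rightarrow> 'v \<Rightarrow> 'k::field"
  assumes skew: "\<And>i j k l m. F i j k l m = - F j i k l m"
    and pair: "\<And>i j k l m. F i j k l m = F k l i j m"
    and bianchi: "\<And>i j k l m. F i j k l m + F i k l j m + F i l j k m = 0"
    and bianchi2: "\<And>i j k l m. F i j k l m + F i j l m k + F i j m k l = 0"
  shows "young5 F i j k l m = 24 * F i j k l m"
proof -
  have row: "row_sum5 F a b c d e = 2 * (F a d b e c + F a e b d c + F b d c e a + F b e c d a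
      + F a d c e b + F a e c d b)" for a b c d e
    using pair[of b d a e c] pair[of b e a d c] pair[of c d b e a] pair[of c e b d a]
      pair[of c d a e b] pair[of c e a d b] by (simp add: row_sum5_def algebra_simps)
  have skew': "F a b d e m = - F a b e d m" for a b d e m
    using pair[of a b d e m] skew[of d e a b m] pair[of a b e d m] by simp
  have exchange: "F a d c b m = F a b c d m + F b d c a m" for a b c d m
    using curvature_exchange[where F = "\<lambda>a b c d. F a b c d m" and i = a and l = d and k = c and j = b,
        OF skew pair bianchi]
    by (simp add: algebra_simps)
  \<comment> \<open>The terms are grouped by the vector in slot 5. Those with \<open>m\<close> there
    give 12 as in order four; those with \<open>k\<close> or \<open>l\<close> give the first
    bracket, those with \<open>i\<close> or \<open>j\<close> the second.\<close>
  have "young5 F i j k l m =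
     4 * (3 * F i j k l m)
     + 6 * (F i j m l k - F i j m k l) + 6 * (F k l m j i - F k l m i j)"
    unfolding young5_def row
    by (simp only: exchange[of i l k j m] exchange[of i k l j m] exchange[of i l m j k] exchange[of i k m j l]
          exchange[of k j m l i] exchange[of k i m l j]
          skew[of j i k l m] skew'[of i j l k m] skew[of j i l k m]
          skew[of j i m k l] skew[of j i m l k] skew[of l k m i j] skew[of l k m j i])
       (simp add: algebra_simps)
  \<comment> \<open>The second Bianchi identity turns each bracket into \<open>F i j k l m\<close>,
    so the total is 12 + 6 + 6 = 24.\<close>
  moreover have last: "F i j m l k - F i j m k l = F i j k l m" for i j k l m
  proof -
    have "F i j l m k = - (F i j k l m + F i j m k l)"
      using bianchi2[of i j k l m] by (simp only: eq_neg_iff_add_eq_0 add_ac)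
    then show ?thesis
      using skew'[of i j m l k] by simp
  qed
  moreover have "F k l m j i - F k l m i j = F i j k l m"
    using last[of k l m j i] pair[of i j k l m] by simp
  ultimately show ?thesis by simp
qed

text \<open>
  If \<open>F\<close> is skew in its first two slots, then \<open>\<xi>\<^sub>\<nu>\<close> applied to \<open>F\<close> with the slots 2 and 3 exchanged is
  congruent to \<^term>\<open>xi_coeff \<nu>\<close> times \<open>F\<close> modulo tensors that are skew in the slots 1 and 3, and
  these are annihilated by the row sums.
\<close>

definition xi_coeff :: "'k::field option \<Rightarrow> 'k" where
  "xi_coeff \<nu> = (case \<nu> of None \<Rightarrow> 2/3 | Some n \<Rightarrow> 2/3 * (2 * n - 1))"

text \<open>This is the origin of the exceptional parameter: 1/2 is the only zero of 2\<nu> - 1, and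
  the value 2/3 at infinity is nonzero in characteristic 0.\<close>

lemma xi_coeff_eq_0_iff: "xi_coeff \<nu> = 0 \<longleftrightarrow> \<nu> = Some (1/2 :: 'k::field_char_0)"
  by (auto simp: xi_coeff_def field_simps split: option.splits)

lemma xi_action_idem:
  fixes F :: "'v \<Rightarrow> 'v \<Rightarrow> 'v \<Rightarrow> 'k::field_char_0"
  shows "xi_action \<nu> (xi_action \<nu> F) a b c = xi_action \<nu> F a b c"
  by (cases \<nu>) (simp_all add: field_simps)

text \<open>At \<nu> = 1/2 the six coefficients are opposite in pairs under exchange of the first
  and third argument.\<close>

lemma xi_action_half_skew13:
  fixes F :: "'v \<Rightarrow> 'v \<Rightarrow> 'v \<Rightarrow> 'k::field_char_0"
  shows "xi_action (Some (1/2)) F a b c = - xi_action (Some (1/2)) F c b a"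
  by (simp add: field_simps)

lemma xi_action_sum:
  "(\<Sum>e\<in>E. xi_action \<nu> (G e) a b c * h e) = xi_action \<nu> (\<lambda>a b c. \<Sum>e\<in>E. G e a b c * h e) a b c"
proof (cases \<nu>)
  case None
  then show ?thesis
    by (simp add: sum_distrib_left sum_distrib_right sum.distrib sum_subtractf distrib_right
        left_diff_distrib sum_divide_distrib add_divide_distrib diff_divide_distrib)
next
  case (Some n)
  then show ?thesis
    by (simp add: sum_distrib_left sum_distrib_right sum.distrib sum_subtractf algebra_simps
        sum_divide_distrib add_divide_distrib diff_divide_distrib)
qed

lemma row_sum4_xi:
  fixes F :: "'v \<Rightarrow> 'v \<Rightarrow> 'v \<Rightarrow> 'v \<Rightarrow> 'k::field_char_0"
  assumes skew: "\<And>a b c d. F a b c d = - F b a c d"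
  shows "row_sum4 (\<lambda>a b c d. xi_action \<nu> (\<lambda>a b c. F a c b d) a b c) a b d e =
    xi_coeff \<nu> * row_sum4 F a b d e"
proof -
  have *: "row_sum4 (\<lambda>a b c d. xi_action \<nu> (\<lambda>a b c. F a c b d) a b c) a b d e =
    xi_coeff \<nu> * (F a d b e + F b d a e + F a e b d + F b e a d)"
    \<comment> \<open>The instances of \<open>skew\<close> give components that differ in the order
      of the first two arguments a common orientation; the parts that are skew under
      \<open>a \<leftrightarrow> b\<close> then cancel in the row sum.\<close>
    by (cases \<nu>)
       (simp_all add: row_sum4_def xi_coeff_def field_simps
          skew[of d a b e] skew[of b a d e] skew[of d b a e]
          skew[of e a b d] skew[of b a e d] skew[of e b a d])
  then show ?thesis by (simp only: row_sum4_def)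
qed

lemma young4_xi:
  fixes F :: "'v \<Rightarrow> 'v \<Rightarrow> 'v \<Rightarrow> 'v \<Rightarrow> 'k::field_char_0"
  assumes skew: "\<And>a b c d. F a b c d = - F b a c d"
  shows "young4 (\<lambda>a b c d. xi_action \<nu> (\<lambda>a b c. F a c b d) a b c) i j k l =
    xi_coeff \<nu> * young4 F i j k l"
  by (simp add: young4_def row_sum4_xi[OF skew] algebra_simps)

text \<open>Split by the vector of the first row that lands in slot 5. As \<xi> moves only the first
  three slots, this vector is a mere parameter and the result for \<open>row_sum4\<close> carries
  over.\<close>

lemma row_sum5_row_sum4:
  "row_sum5 F a b c d e =
     row_sum4 (\<lambda>w x y z. F w x y z c) a b d e + row_sum4 (\<lambda>w x y z. F w x y z b) a c d e +
     row_sum4 (\<lambda>w x y z. F w x y z a) b c d e"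
  by (simp add: row_sum5_def row_sum4_def add_ac)

lemma young5_xi:
  fixes F :: "'v \<Rightarrow> 'v \<Rightarrow> 'v \<Rightarrow> 'v \<Rightarrow> 'v \<Rightarrow> 'k::field_char_0"
  assumes skew: "\<And>a b c d e. F a b c d e = - F b a c d e"
  shows "young5 (\<lambda>a b c d e. xi_action \<nu> (\<lambda>a b c. F a c b d e) a b c) i j k l m =
    xi_coeff \<nu> * young5 F i j k l m"
  by (simp add: young5_def row_sum5_row_sum4 row_sum4_xi[of "\<lambda>a b c d. F a b c d e" for e, OF skew] algebra_simps)

lemma young4_sum:
  "(\<Sum>e\<in>E. young4 (G e) i j k l) = young4 (\<lambda>a b c d. \<Sum>e\<in>E. G e a b c d) i j k l"
  by (simp add: young4_def row_sum4_def sum.distrib sum_subtractf)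

lemma young5_sum:
  "(\<Sum>e\<in>E. young5 (G e) i j k l m) = young5 (\<lambda>a b c d e. \<Sum>x\<in>E. G x a b c d e) i j k l m"
  by (simp add: young5_def row_sum5_def sum.distrib sum_subtractf)

lemma young5_add_scaled:
  fixes F :: "'v \<Rightarrow> 'v \<Rightarrow> 'v \<Rightarrow> 'v \<Rightarrow> 'v \<Rightarrow> 'k::field"
  shows "young5 (\<lambda>a b c d e. F a b c d e + x * G a b c d e) i j k l m =
     young5 F i j k l m + x * young5 G i j k l m"
  by (simp add: young5_def row_sum5_def algebra_simps)

section \<open>Spaces of tensors\<close>

text \<open>All functions on argument families form a vector space under pointwise operations; its
  span is the one in \<open>tensor_span\<close>, and the tensor spaces are treated as its
  subspaces.\<close>

interpretation tensor: vector_space "\<lambda>c (T :: ('k::field, 'v) tensor) v. c * T v"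
  by standard (auto simp: fun_eq_iff algebra_simps)

lemma sum_fun_apply: "(\<Sum>x\<in>A. f x) v = (\<Sum>x\<in>A. f x v)"
  by (induction A rule: infinite_finite_induct) auto

lemma tensors_iff:
  assumes "vector_space scale"
  shows "T \<in> tensors scale r \<longleftrightarrow>
    (\<forall>v w. (\<forall>i\<in>{1..r}. v i = w i) \<longrightarrow> T v = T w) \<and>
    (\<forall>v. \<forall>i\<in>{1..r}. (\<forall>x y. T (v(i := x + y)) = T (v(i := x)) + T (v(i := y))) \<and>
       (\<forall>c x. T (v(i := scale c x)) = c * T (v(i := x))))"
proof -
  have "vector_space ((*) :: 'a \<Rightarrow> 'a \<Rightarrow> 'a)"
    by standard (simp_all add: algebra_simps)
  with assms show ?thesis
    by (simp add: tensors_def Vector_Spaces.linear_iff)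
qed

lemma tensors_cong:
  assumes "T \<in> tensors scale r" "\<And>i. 1 \<le> i \<Longrightarrow> i \<le> r \<Longrightarrow> v i = w i"
  shows "T v = T w"
  using assms by (auto simp: tensors_def)

lemma subspace_tensors: "vector_space scale \<Longrightarrow> tensor.subspace (tensors scale r)"
  unfolding tensor.subspace_def by (auto simp: tensors_iff algebra_simps) metis+

lemma tensors_compose:
  assumes "T \<in> tensors scale r" "p permutes {1..r}"
  shows "(\<lambda>v. T (v \<circ> p)) \<in> tensors scale r"
proof -
  have "Vector_Spaces.linear scale (*) (\<lambda>x. T (v(i := x) \<circ> p))" if "i \<in> {1..r}" for v i
  proof -
    have "v(i := x) \<circ> p = (v \<circ> p)(inv p i := x)" for x
      using assms(2) by (auto simp: fun_eq_iff permutes_inverses)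
    moreover have "inv p i \<in> {1..r}"
      using that permutes_in_image[OF permutes_inv[OF assms(2)]] by blast
    ultimately show ?thesis
      using assms(1) by (simp add: tensors_def)
  qed
  moreover have "T (v \<circ> p) = T (w \<circ> p)" if "\<forall>i\<in>{1..r}. v i = w i" for v w
    using assms(1) by (rule tensors_cong) (use that permutes_in_image[OF assms(2)] in auto)
  ultimately show ?thesis
    by (simp add: tensors_def)
qed

lemma act_in_tensors:
  assumes "vector_space scale" "T \<in> tensors scale r"
  shows "act r a T \<in> tensors scale r"
proof -
  have "act r a T = (\<Sum>p | p permutes {1..r}. (\<lambda>v. a p * T (v \<circ> p)))"
    by (simp add: act_def fun_eq_iff sum_fun_apply)
  also have "\<dots> \<in> tensors scale r"
    using subspace_tensors[OF assms(1)]
    by (intro tensor.subspace_sum tensor.subspace_scale tensors_compose assms) auto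
  finally show ?thesis .
qed

lemma tensor_prod_in_tensors:
  assumes "vector_space scale" "T \<in> tensors scale r" "S \<in> tensors scale s"
  shows "tensor_prod r T S \<in> tensors scale (r + s)"
proof -
  \<comment> \<open>Each slot belongs to exactly one factor: slots up to \<open>r\<close> leave
    \<open>S\<close> unchanged, later ones leave \<open>T\<close> unchanged and act on
    \<open>S\<close> at position \<open>i - r\<close>.\<close>
  have T: "T (v(i := x)) = T v" if "i > r" for v i x
    using that by (intro tensors_cong[OF assms(2)]) auto
  have S: "S (\<lambda>j. (v(i := x)) (r + j)) = S (\<lambda>j. v (r + j))" if "i \<le> r" for v i x
    using that by (intro tensors_cong[OF assms(3)]) auto
  have S': "(\<lambda>j. (v(i := x)) (r + j)) = (\<lambda>j. v (r + j))(i - r := x)" if "i > r" for v :: "nat \<Rightarrow> 'b" and i x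
    using that by (auto simp: fun_eq_iff)
  show ?thesis
    unfolding tensors_iff[OF assms(1)] tensor_prod_def
  proof (intro conjI allI impI ballI)
    fix v w :: "nat \<Rightarrow> 'b" assume "\<forall>i\<in>{1..r + s}. v i = w i"
    then show "T v * S (\<lambda>i. v (r + i)) = T w * S (\<lambda>i. w (r + i))"
      by (intro arg_cong2[where f = "(*)"] tensors_cong[OF assms(2)] tensors_cong[OF assms(3)]) auto
  next
    fix v :: "nat \<Rightarrow> 'b" and i x y assume i: "i \<in> {1..r + s}"
    show "T (v(i := x + y)) * S (\<lambda>j. (v(i := x + y)) (r + j)) =
      T (v(i := x)) * S (\<lambda>j. (v(i := x)) (r + j)) + T (v(i := y)) * S (\<lambda>j. (v(i := y)) (r + j))"
    proof (cases "i \<le> r")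
      case True
      then show ?thesis
        using i assms(2) by (simp only: S tensors_iff[OF assms(1)]) (simp add: algebra_simps)
    next
      case False
      then have "i - r \<in> {1..s}" "i > r" using i by auto
      then show ?thesis
        using assms(3) by (simp only: S' T tensors_iff[OF assms(1)]) (simp add: algebra_simps)
    qed
  next
    fix v :: "nat \<Rightarrow> 'b" and i c x assume i: "i \<in> {1..r + s}"
    show "T (v(i := scale c x)) * S (\<lambda>j. (v(i := scale c x)) (r + j)) =
      c * (T (v(i := x)) * S (\<lambda>j. (v(i := x)) (r + j)))"
    proof (cases "i \<le> r")
      case True
      then show ?thesis
        using i assms(2) by (simp only: S tensors_iff[OF assms(1)]) (simp add: algebra_simps)
    next
      case False
      then have "i - r \<in> {1..s}" "i > r" using i by auto
      then show ?thesis
        using assms(3) by (simp only: S' T tensors_iff[OF assms(1)]) (simp add: algebra_simps)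
    qed
  qed
qed

lemma args_nth: "1 \<le> i \<Longrightarrow> i \<le> length xs \<Longrightarrow> args xs i = xs ! (i - 1)"
  by (simp add: args_def)

lemma tensor3_eq: "T \<in> tensors scale 3 \<Longrightarrow> T v = T (args [v 1, v 2, v 3])"
  by (erule tensors_cong) (auto simp: args_nth le_Suc_eq numeral_eq_Suc)

lemma tensor4_eq: "T \<in> tensors scale 4 \<Longrightarrow> T v = T (args [v 1, v 2, v 3, v 4])"
  by (erule tensors_cong) (auto simp: args_nth le_Suc_eq numeral_eq_Suc)

lemma tensor5_eq: "T \<in> tensors scale 5 \<Longrightarrow> T v = T (args [v 1, v 2, v 3, v 4, v 5])"
  by (erule tensors_cong) (auto simp: args_nth le_Suc_eq numeral_eq_Suc)

text \<open>Slots are counted from 1 and list positions from 0, hence the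
  \<open>Suc\<close>.\<close>

lemma args_list_update: "i < length xs \<Longrightarrow> (args xs)(Suc i := x) = args (xs[i := x])"
  by (auto simp: args_def fun_eq_iff nth_list_update)

lemma linear_slot:
  assumes "T \<in> tensors scale r" "i < r" "i < length xs"
  shows "Vector_Spaces.linear scale (*) (\<lambda>x. T (args (xs[i := x])))"
proof -
  have "Vector_Spaces.linear scale (*) (\<lambda>x. T ((args xs)(Suc i := x)))"
    using assms(1,2) by (simp add: tensors_def)
  then show ?thesis
    by (simp add: args_list_update assms(3))
qed

abbreviation young_2_2 :: "('k::field, 'v) tensor \<Rightarrow> ('k, 'v) tensor" where
  "young_2_2 \<equiv> act 4 (star (young_symmetrizer [[1,3],[2,4]]))"

abbreviation young_3_2 :: "('k::field, 'v) tensor \<Rightarrow> ('k, 'v) tensor" where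
  "young_3_2 \<equiv> act 5 (star (young_symmetrizer [[1,3,5],[2,4]]))"

lemma args_simps [simp]:
  "args [a,b,c] 1 = a" "args [a,b,c] 2 = b" "args [a,b,c] 3 = c"
  "args [a,b,c,d] 1 = a" "args [a,b,c,d] 2 = b" "args [a,b,c,d] 3 = c" "args [a,b,c,d] 4 = d"
  "args [a,b,c,d,e] 1 = a" "args [a,b,c,d,e] 2 = b" "args [a,b,c,d,e] 3 = c" "args [a,b,c,d,e] 4 = d"
  "args [a,b,c,d,e] 5 = e" "args [a,b] 1 = a" "args [a,b] 2 = b"
  by (simp_all add: args_def)

text \<open>Supplies the easy inclusion: since \<open>young4_identities\<close> hold for every
  \<open>F\<close>, all generators are curvature tensors.\<close>

lemma young_2_2_in_curvature_tensors:
  assumes "vector_space scale" "T \<in> tensors scale 4"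
  shows "young_2_2 T \<in> curvature_tensors scale"
proof -
  have T: "young_2_2 T v = young4 (\<lambda>a b c d. T (args [a, b, c, d])) (v 1) (v 2) (v 3) (v 4)" for v
    by (rule act_young_2_2) (rule tensor4_eq[OF assms(2)])
  have eq: "young_2_2 T (args [i,j,k,l]) = young4 (\<lambda>a b c d. T (args [a, b, c, d])) i j k l" for i j k l
    by (simp only: T args_simps)
  show ?thesis
    unfolding curvature_tensors_def mem_Collect_eq eq
    by (intro conjI allI act_in_tensors[OF assms] young4_identities)
qed

lemma young_3_2_in_derivative_curvature_tensors:
  assumes "vector_space scale" "T \<in> tensors scale 5"
  shows "young_3_2 T \<in> derivative_curvature_tensors scale"
proof -
  have T: "young_3_2 T v =
      young5 (\<lambda>a b c d e. T (args [a, b, c, d, e])) (v 1) (v 2) (v 3) (v 4) (v 5)" for v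
    by (rule act_young_3_2) (rule tensor5_eq[OF assms(2)])
  have eq: "young_3_2 T (args [i,j,k,l,m]) = young5 (\<lambda>a b c d e. T (args [a, b, c, d, e])) i j k l m"
    for i j k l m
    by (simp only: T args_simps)
  show ?thesis
    unfolding derivative_curvature_tensors_def mem_Collect_eq eq
    by (intro conjI allI act_in_tensors[OF assms] young5_identities)
qed

text \<open>Closure rules for the syntactic shapes of the curvature identities under addition and
  scaling, used in the two subspace proofs that follow.\<close>

lemma linear_relations:
  fixes x y z :: "'k::field"
  shows "x = - y \<Longrightarrow> x' = - y' \<Longrightarrow> x + x' = - (y + y')"
    "x + y + z = 0 \<Longrightarrow> x' + y' + z' = 0 \<Longrightarrow> (x + x') + (y + y') + (z + z') = 0"
    "x = - y \<Longrightarrow> c * x = - (c * y)"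
    "x + y + z = 0 \<Longrightarrow> c * x + c * y + c * z = 0"
proof -
  assume "x + y + z = 0" "x' + y' + z' = 0"
  then have "(x + y + z) + (x' + y' + z') = 0" by simp
  then show "(x + x') + (y + y') + (z + z') = 0" by (simp add: add_ac)
qed (simp_all flip: distrib_left)

lemma subspace_curvature_tensors:
  assumes "vector_space scale"
  shows "tensor.subspace (curvature_tensors scale)"
proof (rule tensor.subspaceI)
  show "0 \<in> curvature_tensors scale"
    using tensor.subspace_0[OF subspace_tensors[OF assms]] by (simp add: curvature_tensors_def)
next
  fix T S assume "T \<in> curvature_tensors scale" "S \<in> curvature_tensors scale"
  then show "T + S \<in> curvature_tensors scale"
    using tensor.subspace_add[OF subspace_tensors[OF assms], of T 4 S]
    unfolding curvature_tensors_def mem_Collect_eq plus_fun_apply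
    by (intro conjI allI linear_relations arg_cong2[where f = "(+)"]) meson+
next
  fix c T assume "T \<in> curvature_tensors scale"
  then show "(\<lambda>v. c * T v) \<in> curvature_tensors scale"
    using tensor.subspace_scale[OF subspace_tensors[OF assms], of T 4 c]
    unfolding curvature_tensors_def mem_Collect_eq
    by (intro conjI allI linear_relations arg_cong2[where f = "(*)"] refl) meson+
qed

lemma subspace_derivative_curvature_tensors:
  assumes "vector_space scale"
  shows "tensor.subspace (derivative_curvature_tensors scale)"
proof (rule tensor.subspaceI)
  show "0 \<in> derivative_curvature_tensors scale"
    using tensor.subspace_0[OF subspace_tensors[OF assms]] by (simp add: derivative_curvature_tensors_def)
next
  fix T S assume "T \<in> derivative_curvature_tensors scale" "S \<in> derivative_curvature_tensors scale"
  then show "T + S \<in> derivative_curvature_tensors scale"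
    using tensor.subspace_add[OF subspace_tensors[OF assms], of T 5 S]
    unfolding derivative_curvature_tensors_def mem_Collect_eq plus_fun_apply
    by (intro conjI allI linear_relations arg_cong2[where f = "(+)"]) meson+
next
  fix c T assume "T \<in> derivative_curvature_tensors scale"
  then show "(\<lambda>v. c * T v) \<in> derivative_curvature_tensors scale"
    using tensor.subspace_scale[OF subspace_tensors[OF assms], of T 5 c]
    unfolding derivative_curvature_tensors_def mem_Collect_eq
    by (intro conjI allI linear_relations arg_cong2[where f = "(*)"] refl) meson+
qed

text \<open>By idempotence of \<open>xi \<nu>\<close>, everything in its image is fixed by
  it.\<close>

lemma act_xi_in_sym_class:
  fixes T :: "('k::field_char_0, 'v::ab_group_add) tensor"
  assumes "vector_space scale" "T \<in> tensors scale 3"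
  shows "act 3 (xi \<nu>) T \<in> sym_class scale \<nu>"
proof -
  have T: "T v = (\<lambda>a b c. T (args [a, b, c])) (v 1) (v 2) (v 3)" for v
    using tensor3_eq[OF assms(2)] by simp
  have "act 3 (xi \<nu>) T v = xi_action \<nu> (\<lambda>a b c. T (args [a, b, c])) (v 1) (v 2) (v 3)" for v
    by (rule act_xi) (rule T)
  then have "act 3 (xi \<nu>) (act 3 (xi \<nu>) T) v = act 3 (xi \<nu>) T v" for v
    by (subst act_xi[where F = "xi_action \<nu> (\<lambda>a b c. T (args [a, b, c]))"]) (simp_all only: xi_action_idem)
  then show ?thesis
    using act_in_tensors[OF assms] by (auto simp: sym_class_def)
qed

text \<open>Such a \<open>U\<close> equals its own image under \<open>xi\<close>, and at \<nu> = 1/2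
  every image has this skewness.\<close>

lemma sym_class_half_skew13:
  fixes U :: "('k::field_char_0, 'v::ab_group_add) tensor"
  assumes "U \<in> sym_class scale (Some (1/2))"
  shows "U (args [a, b, c]) = - U (args [c, b, a])"
proof -
  have U: "U \<in> tensors scale 3" "act 3 (xi (Some (1/2))) U = U"
    using assms by (auto simp: sym_class_def)
  have "U v = (\<lambda>a b c. U (args [a, b, c])) (v 1) (v 2) (v 3)" for v
    using tensor3_eq[OF U(1)] by simp
  then have *: "U v = xi_action (Some (1/2)) (\<lambda>a b c. U (args [a, b, c])) (v 1) (v 2) (v 3)" for v
    by (subst U(2)[symmetric], intro act_xi)
  have eq: "U (args [a, b, c]) = xi_action (Some (1/2)) (\<lambda>a b c. U (args [a, b, c])) a b c" for a b c
    using *[of "args [a, b, c]"] by (simp only: args_simps)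
  have "U (args [a, b, c]) = - xi_action (Some (1/2)) (\<lambda>a b c. U (args [a, b, c])) c b a"
    using eq[of a b c] xi_action_half_skew13 by (rule trans)
  then show ?thesis
    by (simp only: eq[symmetric])
qed

lemma tensor_prod_4:
  assumes "U \<in> tensors scale 3" "w \<in> tensors scale 1"
  shows "tensor_prod 3 U w v = U (args [v 1, v 2, v 3]) * w (args [v 4])"
  unfolding tensor_prod_def
  by (intro arg_cong2[where f = "(*)"] tensors_cong[OF assms(1)] tensors_cong[OF assms(2)])
     (auto simp: args_nth le_Suc_eq numeral_eq_Suc)

lemma tensor_prod_5:
  assumes "U \<in> tensors scale 3" "S \<in> tensors scale 2"
  shows "tensor_prod 3 U S v = U (args [v 1, v 2, v 3]) * S (args [v 4, v 5])"
  unfolding tensor_prod_def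
  by (intro arg_cong2[where f = "(*)"] tensors_cong[OF assms(1)] tensors_cong[OF assms(2)])
     (auto simp: args_nth le_Suc_eq numeral_eq_Suc)

text \<open>The second factor occupies slot 4 only, so the product inherits the skewness of
  \<open>U\<close> in the slots 1 and 3 and row symmetrisation destroys it.\<close>

lemma young_2_2_sym_class_half:
  fixes U :: "('k::field_char_0, 'v::ab_group_add) tensor"
  assumes "U \<in> sym_class scale (Some (1/2))" "w \<in> tensors scale 1"
  shows "young_2_2 (tensor_prod 3 U w) = 0"
proof
  fix v
  have U: "U \<in> tensors scale 3" using assms(1) by (simp add: sym_class_def)
  have "young_2_2 (tensor_prod 3 U w) v =
     young4 (\<lambda>a b c d. U (args [a, b, c]) * w (args [d])) (v 1) (v 2) (v 3) (v 4)"
    by (rule act_young_2_2) (rule tensor_prod_4[OF U assms(2)])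
  also have "\<dots> = 0"
    by (rule young4_skew13) (subst sym_class_half_skew13[OF assms(1)], simp)
  finally show "young_2_2 (tensor_prod 3 U w) v = 0 v" by simp
qed

lemma young_3_2_sym_class_half:
  fixes U :: "('k::field_char_0, 'v::ab_group_add) tensor"
  assumes "U \<in> sym_class scale (Some (1/2))" "S \<in> tensors scale 2"
  shows "young_3_2 (tensor_prod 3 U S) = 0"
proof
  fix v
  have U: "U \<in> tensors scale 3" using assms(1) by (simp add: sym_class_def)
  have "young_3_2 (tensor_prod 3 U S) v =
     young5 (\<lambda>a b c d e. U (args [a, b, c]) * S (args [d, e])) (v 1) (v 2) (v 3) (v 4) (v 5)"
    by (rule act_young_3_2) (rule tensor_prod_5[OF U assms(2)])
  also have "\<dots> = 0"
    by (rule young5_skew13) (subst sym_class_half_skew13[OF assms(1)], simp)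
  finally show "young_3_2 (tensor_prod 3 U S) v = 0 v" by simp
qed

section \<open>The dual basis\<close>

definition coord :: "('k::field \<Rightarrow> 'v::ab_group_add \<Rightarrow> 'v) \<Rightarrow> 'v set \<Rightarrow> 'v \<Rightarrow> 'v \<Rightarrow> 'k" where
  "coord scale B b v = module.representation scale B v b"

lemma coord:
  assumes "finite_dimensional_vector_space scale B"
  shows linear_coord: "Vector_Spaces.linear scale (*) (coord scale B b)"
    and sum_coord: "(\<Sum>b\<in>B. scale (coord scale B b v) b) = v"
    and coord_basis: "b \<in> B \<Longrightarrow> c \<in> B \<Longrightarrow> coord scale B b c = (if b = c then 1 else 0)"
proof -
  interpret finite_dimensional_vector_space scale B by fact
  have "coord scale B b = (\<lambda>v. representation B v b)"
    by (simp add: coord_def fun_eq_iff)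
  then show "Vector_Spaces.linear scale (*) (coord scale B b)"
    using linear_representation[OF independent_Basis span_Basis] by simp
  show "(\<Sum>b\<in>B. scale (coord scale B b v) b) = v"
    unfolding coord_def
    by (rule sum_representation_eq) (auto simp: independent_Basis span_Basis finite_Basis)
  show "b \<in> B \<Longrightarrow> c \<in> B \<Longrightarrow> coord scale B b c = (if b = c then 1 else 0)"
    by (simp add: coord_def representation_basis[OF independent_Basis])
qed

lemma coord_in_tensors:
  assumes "finite_dimensional_vector_space scale B"
  shows "(\<lambda>v. coord scale B b (v 1)) \<in> tensors scale 1"
  using linear_coord[OF assms, of b] by (auto simp: tensors_def eta_contract_eq)

text \<open>Applied to one slot of a tensor, this splits the slot off as a tensor factor: the slot
  is frozen at basis vectors and multiplied by dual coordinates.\<close>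

lemma linear_coord_expansion:
  assumes "finite_dimensional_vector_space scale B" "Vector_Spaces.linear scale (*) f"
  shows "(\<Sum>b\<in>B. f b * coord scale B b v) = f v"
proof -
  have "f v = f (\<Sum>b\<in>B. scale (coord scale B b v) b)"
    by (simp add: sum_coord[OF assms(1)])
  also have "\<dots> = (\<Sum>b\<in>B. f (scale (coord scale B b v) b))"
    using assms(2) unfolding module_hom_iff_linear[symmetric] by (rule module_hom.sum)
  also have "\<dots> = (\<Sum>b\<in>B. f b * coord scale B b v)"
    using assms(2) by (simp add: Vector_Spaces.linear_iff mult.commute)
  finally show ?thesis by simp
qed

section \<open>Generating curvature tensors\<close>

lemma tensor_span_eq: "tensor_span = tensor.span"
  by (simp add: tensor_span_def)

lemma finite_dimensional_imp_vector_space: "finite_dimensional_vector_space scale B \<Longrightarrow> vector_space scale"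
  by (simp add: finite_dimensional_vector_space_def)

lemma slice_1_3_2_in_tensors:
  assumes vs: "vector_space scale" and R: "R \<in> tensors scale r" "3 \<le> r" and xs: "r = 3 + length xs"
  shows "(\<lambda>v. R (args (v 1 # v 3 # v 2 # xs))) \<in> tensors scale 3"
proof -
  let ?ys = "\<lambda>v :: nat \<Rightarrow> _. v 1 # v 3 # v 2 # xs"
  have "Vector_Spaces.linear scale (*) (\<lambda>x. R (args (?ys (v(i := x)))))" if "i \<in> {1..3}" for v i
  proof -
    have "i = 1 \<or> i = 2 \<or> i = 3" using that by auto
    then show ?thesis
      using linear_slot[OF R(1), of 0 "?ys v"] linear_slot[OF R(1), of 1 "?ys v"]
        linear_slot[OF R(1), of 2 "?ys v"] R(2) by auto
  qed
  then show ?thesis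
    by (auto simp: tensors_def)
qed

lemma curvature_in_span:
  fixes scale :: "'k::field_char_0 \<Rightarrow> 'v::ab_group_add \<Rightarrow> 'v"
  assumes fd: "finite_dimensional_vector_space scale B" and "\<nu> \<noteq> Some (1/2)"
    and R: "R \<in> curvature_tensors scale"
  shows "R \<in> tensor_span {young_2_2 (tensor_prod 3 U w) | U w. U \<in> sym_class scale \<nu> \<and> w \<in> tensors scale 1}"
proof -
  note vs = finite_dimensional_imp_vector_space[OF fd]
  define F where "F a b c d = R (args [a, b, c, d])" for a b c d
  have R4: "R \<in> tensors scale 4"
    and skew: "\<And>i j k l. F i j k l = - F j i k l"
    and pair: "\<And>i j k l. F i j k l = F k l i j"
    and bianchi: "\<And>i j k l. F i j k l + F i k l j + F i l j k = 0"
    using R unfolding curvature_tensors_def F_def by blast+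
  \<comment> \<open>Slot 4 is frozen at a basis vector \<open>e\<close> and paired with the dual
    functional of \<open>e\<close>, so that summation over the basis restores it.\<close>
  define U where "U e = act 3 (xi \<nu>) (\<lambda>v. R (args [v 1, v 3, v 2, e]))" for e
  define w where "w e = (\<lambda>v :: nat \<Rightarrow> 'v. coord scale B e (v 1))" for e
  have U_eq: "U e v = xi_action \<nu> (\<lambda>a b c. F a c b e) (v 1) (v 2) (v 3)" for e v
    unfolding U_def F_def by (rule act_xi) (rule refl)
  have U: "U e \<in> sym_class scale \<nu>" for e
    unfolding U_def by (rule act_xi_in_sym_class[OF vs slice_1_3_2_in_tensors[OF vs R4]]) simp_all
  have w: "w e \<in> tensors scale 1" for e
    unfolding w_def by (rule coord_in_tensors[OF fd])
  have expand: "(\<Sum>e\<in>B. F a b c e * coord scale B e d) = F a b c d" for a b c d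
    using linear_slot[OF R4, of 3 "[a, b, c, d]"]
    by (intro linear_coord_expansion[OF fd]) (simp add: F_def)
  \<comment> \<open>12 is the eigenvalue of the Young operator on curvature tensors; the other
    factor is what \<xi> contributes after row symmetrisation.\<close>
  define c where "c = 12 * xi_coeff \<nu>"
  have "c \<noteq> 0"
    using assms(2) by (simp add: c_def xi_coeff_eq_0_iff)
  have "(\<Sum>e\<in>B. young_2_2 (tensor_prod 3 (U e) (w e)) v) = c * R v" for v
  proof -
    have "(\<Sum>e\<in>B. young_2_2 (tensor_prod 3 (U e) (w e)) v) =
      (\<Sum>e\<in>B. young4 (\<lambda>a b c d. xi_action \<nu> (\<lambda>a b c. F a c b e) a b c * coord scale B e d)
         (v 1) (v 2) (v 3) (v 4))"
      by (intro sum.cong refl act_young_2_2) (simp add: tensor_prod_def U_eq w_def)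
    also have "\<dots> = young4 (\<lambda>a b c d. xi_action \<nu> (\<lambda>a b c. F a c b d) a b c) (v 1) (v 2) (v 3) (v 4)"
      by (simp only: young4_sum xi_action_sum expand)
    also have "\<dots> = c * F (v 1) (v 2) (v 3) (v 4)"
      unfolding young4_xi[of F, OF skew] young4_curvature[of F, OF skew pair bianchi]
      by (simp add: c_def)
    also have "\<dots> = c * R v"
      by (simp add: F_def tensor4_eq[OF R4, of v])
    finally show ?thesis .
  qed
  then have "R = (\<lambda>v. (1/c) * (\<Sum>e\<in>B. young_2_2 (tensor_prod 3 (U e) (w e))) v)"
    using \<open>c \<noteq> 0\<close> by (simp add: sum_fun_apply)
  then show ?thesis
    unfolding tensor_span_eq
    using U w by (elim ssubst) (intro tensor.span_scale tensor.span_sum tensor.span_base, blast)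
qed

text \<open>The sign \<epsilon> treats the symmetric case (\<epsilon> = 1) and the skew case
  (\<epsilon> = -1) together.\<close>

lemma derivative_curvature_in_span:
  fixes scale :: "'k::field_char_0 \<Rightarrow> 'v::ab_group_add \<Rightarrow> 'v"
  assumes fd: "finite_dimensional_vector_space scale B" and "\<nu> \<noteq> Some (1/2)"
    and R: "R \<in> derivative_curvature_tensors scale" and sgn: "\<epsilon> * \<epsilon> = 1"
  shows "R \<in> tensor_span {young_3_2 (tensor_prod 3 U S) | U S. U \<in> sym_class scale \<nu> \<and>
    S \<in> {S \<in> tensors scale 2. \<forall>x y. S (args [x, y]) = \<epsilon> * S (args [y, x])}}"
proof -
  note vs = finite_dimensional_imp_vector_space[OF fd]
  define F where "F a b c d e = R (args [a, b, c, d, e])" for a b c d e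
  have R5: "R \<in> tensors scale 5"
    and skew: "\<And>i j k l m. F i j k l m = - F j i k l m"
    and pair: "\<And>i j k l m. F i j k l m = F k l i j m"
    and bianchi: "\<And>i j k l m. F i j k l m + F i k l j m + F i l j k m = 0"
    and bianchi2: "\<And>i j k l m. F i j k l m + F i j l m k + F i j m k l = 0"
    using R unfolding derivative_curvature_tensors_def F_def by blast+
  \<comment> \<open>\<open>G\<close> is, without normalisation, the (skew-)symmetrisation of
    \<open>F\<close> in the slots 4 and 5. It stays skew in the slots 1 and 2, as
    \<open>young5_xi\<close> demands.\<close>
  define G where "G a b c d e = F a b c d e + \<epsilon> * F a b c e d" for a b c d e
  have G_skew: "G a b c d e = - G b a c d e" for a b c d e
    using skew[of a b c d e] skew[of a b c e d] by (simp add: G_def)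
  \<comment> \<open>Now the slots 4 and 5 are both frozen, at a pair \<open>p\<close> of basis
    vectors; \<open>S p\<close> is the (skew-)symmetrised product of the dual functionals.\<close>
  define U where "U p = act 3 (xi \<nu>) (\<lambda>v. R (args [v 1, v 3, v 2, fst p, snd p]))" for p
  define S where "S p = (\<lambda>v :: nat \<Rightarrow> 'v. coord scale B (fst p) (v 1) * coord scale B (snd p) (v 2)
    + \<epsilon> * (coord scale B (snd p) (v 1) * coord scale B (fst p) (v 2)))" for p
  have U_eq: "U p v = xi_action \<nu> (\<lambda>a b c. F a c b (fst p) (snd p)) (v 1) (v 2) (v 3)" for p v
    unfolding U_def F_def by (rule act_xi) (rule refl)
  have U: "U p \<in> sym_class scale \<nu>" for p
    unfolding U_def by (rule act_xi_in_sym_class[OF vs slice_1_3_2_in_tensors[OF vs R5]]) simp_all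
  have S: "S p \<in> {S \<in> tensors scale 2. \<forall>x y. S (args [x, y]) = \<epsilon> * S (args [y, x])}" for p
  proof -
    have prod: "(\<lambda>v. coord scale B x (v 1) * coord scale B y (v 2)) \<in> tensors scale 2" for x y
      using tensor_prod_in_tensors[OF vs coord_in_tensors[OF fd, of x] coord_in_tensors[OF fd, of y]]
      by (simp add: tensor_prod_def numeral_2_eq_2)
    have "S p = (\<lambda>v. coord scale B (fst p) (v 1) * coord scale B (snd p) (v 2))
       + (\<lambda>v. \<epsilon> * (coord scale B (snd p) (v 1) * coord scale B (fst p) (v 2)))"
      by (simp add: S_def fun_eq_iff)
    also have "\<dots> \<in> tensors scale 2"
      by (intro tensor.subspace_add tensor.subspace_scale subspace_tensors[OF vs] prod)
    finally have "S p \<in> tensors scale 2" .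
    moreover have "S p (args [x, y]) = \<epsilon> * S p (args [y, x])" for x y
    proof -
      have "\<epsilon> * (\<epsilon> * z) = z" for z using sgn by (simp flip: mult.assoc)
      then show ?thesis by (simp add: S_def args_def algebra_simps)
    qed
    ultimately show ?thesis
      unfolding mem_Collect_eq by (intro conjI allI)
  qed
  have expand4: "(\<Sum>x\<in>B. F a b c x e * coord scale B x d) = F a b c d e" for a b c d e
    using linear_slot[OF R5, of 3 "[a, b, c, d, e]"]
    by (intro linear_coord_expansion[OF fd]) (simp add: F_def)
  have expand5: "(\<Sum>y\<in>B. F a b c d y * coord scale B y e) = F a b c d e" for a b c d e
    using linear_slot[OF R5, of 4 "[a, b, c, d, e]"]
    by (intro linear_coord_expansion[OF fd]) (simp add: F_def)
  \<comment> \<open>In the \<epsilon>-summand the two functionals trade arguments, so the expansion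
    yields \<open>F\<close> with the slots 4 and 5 exchanged; altogether this is
    \<open>G\<close>.\<close>
  have expand: "(\<Sum>p\<in>B \<times> B. F a b c (fst p) (snd p) * (coord scale B (fst p) d * coord scale B (snd p) e
      + \<epsilon> * (coord scale B (snd p) d * coord scale B (fst p) e))) = G a b c d e" for a b c d e
  proof -
    have *: "(\<Sum>x\<in>B. \<Sum>y\<in>B. F a b c x y * coord scale B y e * coord scale B x d) = F a b c d e" for d e
      by (simp only: sum_distrib_right[symmetric] expand5 expand4)
    have "(\<Sum>p\<in>B \<times> B. F a b c (fst p) (snd p) * (coord scale B (fst p) d * coord scale B (snd p) e
      + \<epsilon> * (coord scale B (snd p) d * coord scale B (fst p) e))) =
      (\<Sum>x\<in>B. \<Sum>y\<in>B. F a b c x y * coord scale B y e * coord scale B x d) +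
      \<epsilon> * (\<Sum>x\<in>B. \<Sum>y\<in>B. F a b c x y * coord scale B y d * coord scale B x e)"
      by (simp add: sum.cartesian_product' sum_distrib_left sum.distrib algebra_simps)
    then show ?thesis
      by (simp only: * G_def)
  qed
  define c where "c = 24 * xi_coeff \<nu>"
  have "c \<noteq> 0"
    using assms(2) by (simp add: c_def xi_coeff_eq_0_iff)
  have "(\<Sum>p\<in>B \<times> B. young_3_2 (tensor_prod 3 (U p) (S p)) v) = c * R v" for v
  proof -
    have "(\<Sum>p\<in>B \<times> B. young_3_2 (tensor_prod 3 (U p) (S p)) v) =
      (\<Sum>p\<in>B \<times> B. young5 (\<lambda>a b c d e. xi_action \<nu> (\<lambda>a b c. F a c b (fst p) (snd p)) a b c *
         (coord scale B (fst p) d * coord scale B (snd p) e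
          + \<epsilon> * (coord scale B (snd p) d * coord scale B (fst p) e)))
         (v 1) (v 2) (v 3) (v 4) (v 5))"
      by (intro sum.cong refl act_young_3_2) (simp add: tensor_prod_def U_eq S_def)
    also have "\<dots> = young5 (\<lambda>a b c d e. xi_action \<nu> (\<lambda>a b c. G a c b d e) a b c) (v 1) (v 2) (v 3) (v 4) (v 5)"
      by (simp only: young5_sum xi_action_sum expand)
    also have "\<dots> = xi_coeff \<nu> * young5 G (v 1) (v 2) (v 3) (v 4) (v 5)"
      by (rule young5_xi[of G, OF G_skew])
    \<comment> \<open>The \<epsilon>-part of \<open>G\<close> is skew in the slots 3 and 5, because
      \<open>F\<close> is skew in 3 and 4, and is annihilated; only the eigenvalue 24 on
      \<open>F\<close> is left.\<close>
    also have "young5 G (v 1) (v 2) (v 3) (v 4) (v 5) = 24 * F (v 1) (v 2) (v 3) (v 4) (v 5)"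
    proof -
      have "F a b c e d = - F a b e c d" for a b c d e
        using pair[of a b c e d] skew[of c e a b d] pair[of a b e c d] by simp
      then have "young5 (\<lambda>a b c d e. F a b c e d) i j k l m = 0" for i j k l m
        by (rule young5_skew34)
      then show ?thesis
        unfolding G_def young5_add_scaled
        using young5_curvature[of F, OF skew pair bianchi bianchi2] by simp
    qed
    also have "xi_coeff \<nu> * (24 * F (v 1) (v 2) (v 3) (v 4) (v 5)) = c * R v"
      by (simp add: F_def c_def tensor5_eq[OF R5, of v])
    finally show ?thesis .
  qed
  then have "R = (\<lambda>v. (1/c) * (\<Sum>p\<in>B \<times> B. young_3_2 (tensor_prod 3 (U p) (S p))) v)"
    using \<open>c \<noteq> 0\<close> by (simp add: sum_fun_apply)
  then show ?thesis
    unfolding tensor_span_eq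
    using U S by (elim ssubst) (intro tensor.span_scale tensor.span_sum tensor.span_base, blast)
qed

section \<open>Nonzero curvature tensors and the equivalences\<close>

lemma nonzero_curvature_tensors:
  fixes scale :: "'k::field_char_0 \<Rightarrow> 'v::ab_group_add \<Rightarrow> 'v"
  assumes fd: "finite_dimensional_vector_space scale B" and "a \<in> B" "b \<in> B" "a \<noteq> b"
  shows "\<exists>R \<in> curvature_tensors scale. R \<noteq> 0" "\<exists>R \<in> derivative_curvature_tensors scale. R \<noteq> 0"
proof -
  note vs = finite_dimensional_imp_vector_space[OF fd]
  define \<alpha> where "\<alpha> = (\<lambda>v :: nat \<Rightarrow> 'v. coord scale B a (v 1))"
  define \<beta> where "\<beta> = (\<lambda>v :: nat \<Rightarrow> 'v. coord scale B b (v 1))"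
  have \<alpha>: "\<alpha> \<in> tensors scale 1" and \<beta>: "\<beta> \<in> tensors scale 1"
    unfolding \<alpha>_def \<beta>_def by (rule coord_in_tensors[OF fd])+
  have coords: "coord scale B a a = 1" "coord scale B b b = 1" "coord scale B a b = 0" "coord scale B b a = 0"
    using assms(2-4) by (simp_all add: coord_basis[OF fd])
  note prod = tensor_prod_in_tensors[OF vs]
  \<comment> \<open>With \<alpha>, \<beta> dual to \<open>a\<close>, \<open>b\<close>, the witnesses
    are the Young images of \<alpha>\<otimes>\<beta>\<otimes>\<alpha>\<otimes>\<beta> and of its
    product with \<alpha>. Each row of the tableau carries a single functional.\<close>
  define T4 where "T4 = tensor_prod 2 (tensor_prod 1 \<alpha> \<beta>) (tensor_prod 1 \<alpha> \<beta>)"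
  define T5 where "T5 = tensor_prod 4 T4 \<alpha>"
  have T4: "T4 \<in> tensors scale 4"
    using prod[OF prod[OF \<alpha> \<beta>] prod[OF \<alpha> \<beta>]] by (simp add: T4_def numeral_eq_Suc)
  have T5: "T5 \<in> tensors scale 5"
    using prod[OF T4 \<alpha>] by (simp add: T5_def)
  have T4_eq: "T4 v = coord scale B a (v 1) * coord scale B b (v 2) *
      (coord scale B a (v 3) * coord scale B b (v 4))" for v
    by (simp add: T4_def tensor_prod_def \<alpha>_def \<beta>_def numeral_eq_Suc)
  have "young_2_2 T4 (args [a, b, a, b]) = young4 (\<lambda>w x y z. coord scale B a w * coord scale B b x *
      (coord scale B a y * coord scale B b z)) a b a b"
    by (subst act_young_2_2[OF T4_eq]) (simp only: args_simps)
  \<comment> \<open>Only the row sum of the identity column permutation survives, and each of its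
    four terms is 1. In order five the same happens with twelve terms.\<close>
  then have "young_2_2 T4 (args [a, b, a, b]) = 4"
    by (simp add: young4_def row_sum4_def coords)
  then have "young_2_2 T4 \<noteq> 0" by auto
  with young_2_2_in_curvature_tensors[OF vs T4] show "\<exists>R \<in> curvature_tensors scale. R \<noteq> 0" by blast
  have T5_eq: "T5 v = coord scale B a (v 1) * coord scale B b (v 2) *
      (coord scale B a (v 3) * coord scale B b (v 4)) * coord scale B a (v 5)" for v
    by (simp add: T5_def tensor_prod_def T4_eq \<alpha>_def)
  have "young_3_2 T5 (args [a, b, a, b, a]) = young5 (\<lambda>w x y z u. coord scale B a w * coord scale B b x *
      (coord scale B a y * coord scale B b z) * coord scale B a u) a b a b a"
    by (subst act_young_3_2[OF T5_eq]) (simp only: args_simps)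
  then have "young_3_2 T5 (args [a, b, a, b, a]) = 12"
    by (simp add: young5_def row_sum5_def coords)
  then have "young_3_2 T5 \<noteq> 0" by auto
  with young_3_2_in_derivative_curvature_tensors[OF vs T5]
  show "\<exists>R \<in> derivative_curvature_tensors scale. R \<noteq> 0" by blast
qed

text \<open>If \<open>P\<close> holds, both inclusions are available; if it fails, the span is zero
  and differs from \<open>C\<close>, which has a nonzero element.\<close>

lemma tensor_span_eq_iff:
  assumes "tensor.subspace C" "G \<subseteq> C" "\<exists>R\<in>C. R \<noteq> 0"
    and "P \<Longrightarrow> C \<subseteq> tensor_span G" "\<not> P \<Longrightarrow> G \<subseteq> {0}"
  shows "tensor_span G = C \<longleftrightarrow> P"
proof (cases P)
  case True
  then show ?thesis
    using assms(1,2,4) tensor.span_minimal[of G C] unfolding tensor_span_eq by blast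
next
  case False
  then have "tensor_span G \<subseteq> {0}"
    using assms(5) tensor.span_minimal[OF _ tensor.subspace_single_0] unfolding tensor_span_eq by blast
  then show ?thesis
    using False assms(3) by blast
qed

lemma span_derivative_curvature_tensors_iff:
  fixes scale :: "'k::field_char_0 \<Rightarrow> 'v::ab_group_add \<Rightarrow> 'v"
  assumes fd: "finite_dimensional_vector_space scale B" and "a \<in> B" "b \<in> B" "a \<noteq> b"
    and sgn: "\<epsilon> * \<epsilon> = 1" and C: "C = {S \<in> tensors scale 2. \<forall>x y. S (args [x, y]) = \<epsilon> * S (args [y, x])}"
  shows "tensor_span {young_3_2 (tensor_prod 3 U S) | U S. U \<in> sym_class scale \<nu> \<and> S \<in> C} =
    derivative_curvature_tensors scale \<longleftrightarrow> \<nu> \<noteq> Some (1/2)"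
proof (rule tensor_span_eq_iff)
  note vs = finite_dimensional_imp_vector_space[OF fd]
  show "tensor.subspace (derivative_curvature_tensors scale)"
    by (rule subspace_derivative_curvature_tensors[OF vs])
  show "\<exists>R \<in> derivative_curvature_tensors scale. R \<noteq> 0"
    by (rule nonzero_curvature_tensors[OF assms(1-4)])
  show "{young_3_2 (tensor_prod 3 U S) | U S. U \<in> sym_class scale \<nu> \<and> S \<in> C} \<subseteq> derivative_curvature_tensors scale"
    using tensor_prod_in_tensors[OF vs, of _ 3 _ 2]
    by (clarify, intro young_3_2_in_derivative_curvature_tensors[OF vs]) (auto simp: sym_class_def C)
  show "derivative_curvature_tensors scale \<subseteq>
      tensor_span {young_3_2 (tensor_prod 3 U S) | U S. U \<in> sym_class scale \<nu> \<and> S \<in> C}"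
    if "\<nu> \<noteq> Some (1/2)"
    using derivative_curvature_in_span[OF fd that _ sgn] unfolding C by blast
  show "{young_3_2 (tensor_prod 3 U S) | U S. U \<in> sym_class scale \<nu> \<and> S \<in> C} \<subseteq> {0}"
    if "\<not> \<nu> \<noteq> Some (1/2)"
    using that young_3_2_sym_class_half[of _ scale] by (auto simp: C)
qed

theorem theorem10:
  fixes scale :: "'k::real_or_complex \<Rightarrow> 'v::ab_group_add \<Rightarrow> 'v"
    and Basis :: "'v set"
    and \<nu> :: "'k option"
  assumes "finite_dimensional_vector_space scale Basis"
    and "vector_space.dim scale (UNIV :: 'v set) \<ge> 2"
  shows
    "(tensor_span {act 4 (star (young_symmetrizer [[1,3],[2,4]])) (tensor_prod 3 U w) | U w.
         U \<in> sym_class scale \<nu> \<and> w \<in> tensors scale 1} = curvature_tensors scale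
       \<longleftrightarrow> \<nu> \<noteq> Some (1/2)) \<and>
     (tensor_span {act 5 (star (young_symmetrizer [[1,3,5],[2,4]])) (tensor_prod 3 U S) | U S.
         U \<in> sym_class scale \<nu> \<and> S \<in> symmetric_tensors2 scale} = derivative_curvature_tensors scale
       \<longleftrightarrow> \<nu> \<noteq> Some (1/2)) \<and>
     (tensor_span {act 5 (star (young_symmetrizer [[1,3,5],[2,4]])) (tensor_prod 3 U A) | U A.
         U \<in> sym_class scale \<nu> \<and> A \<in> skew_tensors2 scale} = derivative_curvature_tensors scale
       \<longleftrightarrow> \<nu> \<noteq> Some (1/2))"
proof -
  note fd = assms(1)
  note vs = finite_dimensional_imp_vector_space[OF fd]
  have "card Basis \<ge> 2"
    using assms(2) by (simp add: finite_dimensional_vector_space.dim_UNIV[OF fd])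
  \<comment> \<open>This is where dimension at least 2 enters: two distinct basis vectors provide
    the nonzero tensors that are missed when \<nu> = 1/2.\<close>
  then obtain a b where ab: "a \<in> Basis" "b \<in> Basis" "a \<noteq> b"
    by (metis One_nat_def card.empty card_1_singleton_iff card_le_Suc0_iff_eq card.infinite
        not_less_eq_eq numeral_2_eq_2 zero_le)
  have "tensor_span {young_2_2 (tensor_prod 3 U w) | U w. U \<in> sym_class scale \<nu> \<and> w \<in> tensors scale 1} =
    curvature_tensors scale \<longleftrightarrow> \<nu> \<noteq> Some (1/2)"
  proof (rule tensor_span_eq_iff)
    show "tensor.subspace (curvature_tensors scale)"
      by (rule subspace_curvature_tensors[OF vs])
    show "\<exists>R \<in> curvature_tensors scale. R \<noteq> 0"
      by (rule nonzero_curvature_tensors[OF fd ab])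
    show "{young_2_2 (tensor_prod 3 U w) | U w. U \<in> sym_class scale \<nu> \<and> w \<in> tensors scale 1} \<subseteq> curvature_tensors scale"
      using tensor_prod_in_tensors[OF vs, of _ 3 _ 1]
      by (clarify, intro young_2_2_in_curvature_tensors[OF vs]) (auto simp: sym_class_def)
    show "curvature_tensors scale \<subseteq>
        tensor_span {young_2_2 (tensor_prod 3 U w) | U w. U \<in> sym_class scale \<nu> \<and> w \<in> tensors scale 1}"
      if "\<nu> \<noteq> Some (1/2)"
      using curvature_in_span[OF fd that] by blast
    show "{young_2_2 (tensor_prod 3 U w) | U w. U \<in> sym_class scale \<nu> \<and> w \<in> tensors scale 1} \<subseteq> {0}"
      if "\<not> \<nu> \<noteq> Some (1/2)"
      using that young_2_2_sym_class_half[of _ scale] by auto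
  qed
  \<comment> \<open>Both classes are rewritten with an explicit sign, 1 or -1, to become instances
    of the \<epsilon>-version.\<close>
  moreover have "symmetric_tensors2 scale = {S \<in> tensors scale 2. \<forall>x y. S (args [x, y]) = 1 * S (args [y, x])}"
    by (simp add: symmetric_tensors2_def)
  moreover have "skew_tensors2 scale = {S \<in> tensors scale 2. \<forall>x y. S (args [x, y]) = - 1 * S (args [y, x])}"
    by (simp add: skew_tensors2_def)
  ultimately show ?thesis
    using span_derivative_curvature_tensors_iff[OF fd ab, of 1] span_derivative_curvature_tensors_iff[OF fd ab, of "- 1"]
    by simp
qed

end
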